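(* Let $A$ be an $n\times n$ complex matrix with $\|A\|_\infty\le 1$, where $\|A\|_\infty=\sup_{z\in\mathbb{B}_n}|Az|$, regarded as a holomorphic self-map $z\mapsto Az$ of the unit ball $\mathbb{B}_n$. Then the following statements are equivalent. (i) $C_A$ is mean ergodic on $H^\infty(\mathbb{B}_n)$. (ii) $C_A$ is uniformly mean ergodic on $H^\infty(\mathbb{B}_n)$. (iii) $\mathrm{sp}\, A\subset\mathbb{D}\cup\{\lambda\in\partial\mathbb{D}:\ \lambda\text{ is a root of }1\}$.
   Context: $\mathbb{B}_n=\{z\in\mathbb{C}^n: |z|<1\}$ is the open Euclidean unit ball, $\mathbb{D}=\mathbb{B}_1$. $H^\infty(\mathbb{B}_n)$ is the Banach space of bounded holomorphic functions $f:\mathbb{B}_n\to\mathbb{C}$ with the supremum norm. $C_A f=f\circ A$. For a bounded operator $T$ on a Banach space $X$, let $M_j(T)=\frac1j\sum_{i=1}^j T^i$; $T$ is mean ergodic if $M_j(T)$ converges in the strong operator topology to a bounded operator on $X$, and uniformly mean ergodic if $M_j(T)$ converges in operator norm. $\mathrm{sp}\,A$ is the set of eigenvalues of $A$. "Root of $1$" means $\lambda^m=1$ for some integer $m\ge1$. *)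

theory Defs
  imports "HOL-Complex_Analysis.Complex_Analysis"
begin

section \<open>Holomorphic functions of several complex variables\<close>

text \<open>
  The library's holomorphy predicate is for one variable only. On an open set \<open>S\<close> of complex
  \<open>n\<close>-space, \<open>f\<close> is holomorphic if at each point it has a complex-linear Frechet derivative.
  The norm of \<^typ>\<open>complex^'n\<close> is the Euclidean one.
\<close>

definition holomorphic_Cn_on :: "(complex^'n \<Rightarrow> complex) \<Rightarrow> (complex^'n) set \<Rightarrow> bool" where
  "holomorphic_Cn_on f S \<longleftrightarrow>
     (\<forall>z\<in>S. \<exists>D. (f has_derivative D) (at z) \<and> (\<forall>c v. D (c *s v) = c * D v))"

lemma norm_scalar_vector: "norm (c *s (v::complex^'n)) = norm c * norm v"
  by (simp add: norm_vec_def norm_mult L2_set_right_distrib)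

lemma bounded_linear_scalar_left: "bounded_linear (\<lambda>c::complex. c *s (v::complex^'n))"
  by (rule bounded_linear_intro[where K = "norm v"])
     (simp_all add: norm_scalar_vector vec_eq_iff algebra_simps)

lemma holomorphic_Cn_on_const: "holomorphic_Cn_on (\<lambda>_. c) S"
  unfolding holomorphic_Cn_on_def by (intro ballI exI[of _ "\<lambda>_. 0"]) auto

lemma holomorphic_Cn_on_add:
  "holomorphic_Cn_on f S \<Longrightarrow> holomorphic_Cn_on g S \<Longrightarrow> holomorphic_Cn_on (\<lambda>z. f z + g z) S"
  unfolding holomorphic_Cn_on_def
proof (intro ballI, drule (1) bspec, drule (1) bspec, elim exE conjE)
  fix z D E
  assume "(f has_derivative D) (at z)" "(g has_derivative E) (at z)"
    "\<forall>c v. D (c *s v) = c * D v" "\<forall>c v. E (c *s v) = c * E v"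
  then show "\<exists>D. ((\<lambda>z. f z + g z) has_derivative D) (at z) \<and> (\<forall>c v. D (c *s v) = c * D v)"
    by (intro exI[of _ "\<lambda>h. D h + E h"]) (auto intro!: has_derivative_add simp: algebra_simps)
qed

lemma holomorphic_Cn_on_scaleR:
  "holomorphic_Cn_on f S \<Longrightarrow> holomorphic_Cn_on (\<lambda>z. r *\<^sub>R f z) S"
  unfolding holomorphic_Cn_on_def
proof (intro ballI, drule (1) bspec, elim exE conjE)
  fix z D
  assume "(f has_derivative D) (at z)" "\<forall>c v. D (c *s v) = c * D v"
  then show "\<exists>D. ((\<lambda>z. r *\<^sub>R f z) has_derivative D) (at z) \<and> (\<forall>c v. D (c *s v) = c * D v)"
    by (intro exI[of _ "\<lambda>h. r *\<^sub>R D h"]) (auto intro!: has_derivative_scaleR_right)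
qed

lemma holomorphic_Cn_on_minus:
  "holomorphic_Cn_on f S \<Longrightarrow> holomorphic_Cn_on (\<lambda>z. - f z) S"
  using holomorphic_Cn_on_scaleR[of f S "-1"] by simp

lemma holomorphic_Cn_on_diff:
  "holomorphic_Cn_on f S \<Longrightarrow> holomorphic_Cn_on g S \<Longrightarrow> holomorphic_Cn_on (\<lambda>z. f z - g z) S"
  using holomorphic_Cn_on_add[OF _ holomorphic_Cn_on_minus, of f S g] by simp

lemma holomorphic_Cn_on_cong:
  assumes "open S" "\<And>z. z \<in> S \<Longrightarrow> f z = g z" "holomorphic_Cn_on f S"
  shows "holomorphic_Cn_on g S"
  using assms unfolding holomorphic_Cn_on_def
  by (metis has_derivative_transform_within_open)

lemma holomorphic_Cn_on_compose_linear:
  fixes A :: "complex^'n^'n"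
  assumes "holomorphic_Cn_on f S" "\<And>z. z \<in> S \<Longrightarrow> A *v z \<in> S"
  shows "holomorphic_Cn_on (\<lambda>z. f (A *v z)) S"
  unfolding holomorphic_Cn_on_def
proof
  fix z assume "z \<in> S"
  then obtain D where D: "(f has_derivative D) (at (A *v z))" "\<And>c v. D (c *s v) = c * D v"
    using assms unfolding holomorphic_Cn_on_def by blast
  have "((\<lambda>z. A *v z) has_derivative (\<lambda>z. A *v z)) (at z)"
    by (rule bounded_linear_imp_has_derivative) (simp add: matrix_vector_mul_bounded_linear)
  from has_derivative_compose[OF this D(1)]
  have "((\<lambda>z. f (A *v z)) has_derivative (\<lambda>h. D (A *v h))) (at z)" .
  moreover have "D (A *v (c *s v)) = c * D (A *v v)" for c v
  proof -
    have "A *v (c *s v) = c *s (A *v v)"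
      by (simp add: vec_eq_iff matrix_vector_mult_def sum_distrib_left algebra_simps)
    then show ?thesis by (simp add: D(2))
  qed
  ultimately show "\<exists>D. ((\<lambda>z. f (A *v z)) has_derivative D) (at z) \<and> (\<forall>c v. D (c *s v) = c * D v)"
    by blast
qed

text \<open>Cauchy estimate for the derivative, from the one-variable estimate on complex lines.\<close>

lemma holomorphic_Cn_on_derivative_bound:
  fixes f :: "complex^'n \<Rightarrow> complex"
  assumes hol: "holomorphic_Cn_on f S" and S: "ball x r \<subseteq> S" and r: "r > 0"
    and B: "\<And>z. z \<in> S \<Longrightarrow> norm (f z) \<le> B"
    and D: "(f has_derivative D) (at x)" "\<And>c v. D (c *s v) = c * D v"
  shows "norm (D h) \<le> 2 * B / r * norm h"
proof (cases "h = 0")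
  case True
  then have "D h = 0" using D(2)[of 0 h] by simp
  then show ?thesis using True by simp
next
  case False
  define R where "R = r / (2 * norm h)"
  have R: "R > 0" using False r by (simp add: R_def)
  have inS: "x + t *s h \<in> S" if "t \<in> cball 0 R" for t
  proof -
    have "norm (t *s h) \<le> R * norm h"
      using that by (simp add: norm_scalar_vector mult_right_mono)
    also have "\<dots> = r / 2" using False by (simp add: R_def)
    also have "\<dots> < r" using r by simp
    finally show ?thesis using S by (force simp: dist_norm)
  qed
  have line: "((\<lambda>t. x + t *s h) has_derivative (\<lambda>t. t *s h)) (at t)" for t
    using has_derivative_add[OF has_derivative_const
        bounded_linear_imp_has_derivative[OF bounded_linear_scalar_left]] by simp
  have der: "\<exists>d. ((\<lambda>t. f (x + t *s h)) has_field_derivative d) (at t)" if t: "t \<in> cball 0 R" for t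
  proof -
    obtain E where E: "(f has_derivative E) (at (x + t *s h))" "\<And>c v. E (c *s v) = c * E v"
      using hol inS[OF t] unfolding holomorphic_Cn_on_def by blast
    from has_derivative_compose[OF line E(1)]
    have "((\<lambda>t. f (x + t *s h)) has_derivative (\<lambda>s. E h * s)) (at t)"
      by (simp add: E(2) mult.commute)
    then show ?thesis by (auto simp: has_field_derivative_def)
  qed
  have hf: "(\<lambda>t. f (x + t *s h)) holomorphic_on cball 0 R"
    unfolding holomorphic_on_def
  proof
    fix t :: complex assume "t \<in> cball 0 R"
    from der[OF this] show "(\<lambda>t. f (x + t *s h)) field_differentiable at t within cball 0 R"
      unfolding field_differentiable_def by (blast intro: has_field_derivative_at_within)
  qed
  have "norm ((deriv ^^ 1) (\<lambda>t. f (x + t *s h)) 0) \<le> fact 1 * B / R ^ 1"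
  proof (rule Cauchy_inequality)
    show "(\<lambda>t. f (x + t *s h)) holomorphic_on ball 0 R"
      using hf holomorphic_on_subset ball_subset_cball by blast
    show "continuous_on (cball 0 R) (\<lambda>t. f (x + t *s h))"
      using hf by (rule holomorphic_on_imp_continuous_on)
  qed (use R B inS in auto)
  moreover have "((\<lambda>t. f (x + t *s h)) has_field_derivative D h) (at 0)"
  proof -
    have "(f has_derivative D) (at (x + 0 *s h))" using D(1) by simp
    from has_derivative_compose[OF line this]
    have "((\<lambda>t. f (x + t *s h)) has_derivative (\<lambda>s. D h * s)) (at 0)"
      by (simp add: D(2) mult.commute)
    then show ?thesis by (simp add: has_field_derivative_def)
  qed
  ultimately have "norm (D h) \<le> B / R"
    by (simp add: DERIV_imp_deriv)
  then show ?thesis by (simp add: R_def field_simps)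
qed

lemma holomorphic_Cn_on_uniform_limit:
  fixes f :: "nat \<Rightarrow> complex^'n \<Rightarrow> complex"
  assumes hol: "\<And>k. holomorphic_Cn_on (f k) S" and S: "open S"
    and lim: "uniform_limit S f g sequentially"
  shows "holomorphic_Cn_on g S"
  unfolding holomorphic_Cn_on_def
proof
  fix z assume z: "z \<in> S"
  then obtain r0 where r0: "r0 > 0" "ball z r0 \<subseteq> S" using S open_contains_ball by blast
  define r where "r = r0 / 2"
  have r: "r > 0" using r0 by (simp add: r_def)
  have sub: "ball x r \<subseteq> S" if "x \<in> ball z r" for x
  proof -
    have "ball x r \<subseteq> ball z r0"
    proof
      fix y assume "y \<in> ball x r"
      then have "dist z y < r + r" using that dist_triangle[of z y x] by simp
      then show "y \<in> ball z r0" by (simp add: r_def)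
    qed
    then show ?thesis using r0 by blast
  qed
  have sub': "ball z r \<subseteq> S" using sub[of z] r by simp
  define P where "P = (\<lambda>k x D. (f k has_derivative D) (at x) \<and> (\<forall>c v. D (c *s v) = c * D v))"
  define D where "D = (\<lambda>k x. SOME D. P k x D)"
  have "\<exists>D. P k x D" if "x \<in> S" for k x
    using hol[of k] that unfolding holomorphic_Cn_on_def P_def by blast
  then have PD: "P k x (D k x)" if "x \<in> S" for k x
    unfolding D_def using that by (blast intro: someI_ex[of "P k x"])
  have Cauchy: "\<exists>N. \<forall>k\<ge>N. \<forall>m\<ge>N. \<forall>x\<in>ball z r. \<forall>h. norm (D k x h - D m x h) \<le> e * norm h"
    if e: "e > 0" for e
  proof -
    define d where "d = e * r / 4"
    have "d > 0" using e r by (simp add: d_def)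
    then obtain N where N: "\<And>k x. k \<ge> N \<Longrightarrow> x \<in> S \<Longrightarrow> dist (f k x) (g x) < d"
      using lim unfolding uniform_limit_sequentially_iff by blast
    have "norm (D k x h - D m x h) \<le> e * norm h" if "k \<ge> N" "m \<ge> N" "x \<in> ball z r" for k m x h
    proof -
      have xS: "x \<in> S" using sub' that by blast
      have "norm (D k x h - D m x h) \<le> 2 * (2 * d) / r * norm h"
      proof (rule holomorphic_Cn_on_derivative_bound[where D = "\<lambda>h. D k x h - D m x h"
            and f = "\<lambda>x. f k x - f m x", OF holomorphic_Cn_on_diff[OF hol hol] sub[OF that(3)] r])
        show "((\<lambda>x. f k x - f m x) has_derivative (\<lambda>h. D k x h - D m x h)) (at x)"
          using PD[OF xS] unfolding P_def by (intro has_derivative_diff) auto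
        show "D k x (c *s v) - D m x (c *s v) = c * (D k x v - D m x v)" for c v
          using PD[OF xS] unfolding P_def by (simp add: algebra_simps)
        fix y assume "y \<in> S"
        then have "dist (f k y) (g y) < d" "dist (f m y) (g y) < d" using N that by auto
        then have "dist (f k y) (f m y) < 2 * d"
          using dist_triangle2[of "f k y" "f m y" "g y"] by simp
        then show "norm (f k y - f m y) \<le> 2 * d" by (simp add: dist_norm)
      qed
      also have "2 * (2 * d) / r = e" using r by (simp add: d_def)
      finally show ?thesis .
    qed
    then show ?thesis by blast
  qed
  define G where "G = (\<lambda>x h. lim (\<lambda>k. D k x h))"
  have lims: "(\<lambda>k. D k x h) \<longlonglongrightarrow> G x h" if "x \<in> ball z r" for x h
  proof -
    have "Cauchy (\<lambda>k. D k x h)"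
    proof (rule CauchyI)
      fix e :: real assume e: "e > 0"
      define e' where "e' = e / (norm h + 1)"
      have np: "norm h + 1 > 0" by (simp add: add_nonneg_pos)
      have "e' > 0" using e np by (simp add: e'_def)
      then obtain N where N: "\<forall>k\<ge>N. \<forall>m\<ge>N. \<forall>x\<in>ball z r. \<forall>h. norm (D k x h - D m x h) \<le> e' * norm h"
        using Cauchy by blast
      have "e' * norm h < e" using e np by (simp add: e'_def field_simps)
      then show "\<exists>M. \<forall>m\<ge>M. \<forall>n\<ge>M. norm (D m x h - D n x h) < e"
        using N that by (intro exI[of _ N]) (metis order_le_less_trans)
    qed
    then show ?thesis unfolding G_def by (intro convergent_LIMSEQ_iff[THEN iffD1] Cauchy_convergent)
  qed
  have "\<exists>g'. \<forall>x\<in>ball z r. (\<lambda>n. f n x) \<longlonglongrightarrow> g' x \<and> (g' has_derivative G x) (at x within ball z r)"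
  proof (rule has_derivative_sequence[where f' = D])
    show "(f n has_derivative D n x) (at x within ball z r)" if "x \<in> ball z r" for n x
      using PD[of x n] sub' that unfolding P_def by (blast intro: has_derivative_at_withinI)
    fix e :: real assume "e > 0"
    then obtain N where N: "\<forall>k\<ge>N. \<forall>m\<ge>N. \<forall>x\<in>ball z r. \<forall>h. norm (D k x h - D m x h) \<le> e * norm h"
      using Cauchy by blast
    have "norm (D k x h - G x h) \<le> e * norm h" if "k \<ge> N" "x \<in> ball z r" for k x h
    proof (rule Lim_bounded)
      show "(\<lambda>m. norm (D k x h - D m x h)) \<longlonglongrightarrow> norm (D k x h - G x h)"
        by (intro tendsto_intros lims that)
      show "\<forall>m\<ge>N. norm (D k x h - D m x h) \<le> e * norm h" using N that by blast
    qed
    then show "\<forall>\<^sub>F n in sequentially. \<forall>x\<in>ball z r. \<forall>h. norm (D n x h - G x h) \<le> e * norm h"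
      unfolding eventually_sequentially by blast
  next
    show "z \<in> ball z r" using r by simp
    show "(\<lambda>n. f n z) \<longlonglongrightarrow> g z" using tendsto_uniform_limitI[OF lim z] .
  qed auto
  then obtain g' where g': "\<And>x. x \<in> ball z r \<Longrightarrow> (\<lambda>n. f n x) \<longlonglongrightarrow> g' x"
      "\<And>x. x \<in> ball z r \<Longrightarrow> (g' has_derivative G x) (at x within ball z r)" by blast
  have zz: "z \<in> ball z r" using r by simp
  have eq: "g' x = g x" if "x \<in> ball z r" for x
    using LIMSEQ_unique[OF g'(1)[OF that] tendsto_uniform_limitI[OF lim]] sub' that by blast
  have "(g' has_derivative G z) (at z)"
    using g'(2)[OF zz] by (simp add: at_within_open[OF zz])
  then have "(g has_derivative G z) (at z)"
    by (rule has_derivative_transform_within_open[OF _ open_ball zz]) (use eq in auto)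
  moreover have "G z (c *s v) = c * G z v" for c v
  proof (rule LIMSEQ_unique[OF lims[OF zz]])
    have "(\<lambda>k. c * D k z v) \<longlonglongrightarrow> c * G z v" by (intro tendsto_intros lims zz)
    then show "(\<lambda>k. D k z (c *s v)) \<longlonglongrightarrow> c * G z v"
      using PD[OF z] unfolding P_def by simp
  qed
  ultimately show "\<exists>D. (g has_derivative D) (at z) \<and> (\<forall>c v. D (c *s v) = c * D v)" by blast
qed


section \<open>The Banach space of bounded holomorphic functions on the unit ball\<close>

text \<open>
  Elements are represented by functions on the whole space that vanish off the open unit ball,
  so that equality of representatives is equality on the ball.
\<close>

definition Hinf_set :: "(complex^'n \<Rightarrow> complex) set" where
  "Hinf_set = {f. holomorphic_Cn_on f (ball 0 1) \<and> bounded (f ` ball 0 1) \<and>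
                  (\<forall>z. z \<notin> ball 0 1 \<longrightarrow> f z = 0)}"

typedef (overloaded) 'n Hinf = "Hinf_set :: (complex^'n::finite \<Rightarrow> complex) set"
  morphisms apply_Hinf Abs_Hinf
  by (rule exI[of _ "\<lambda>_. 0"]) (auto simp: Hinf_set_def holomorphic_Cn_on_const image_constant_conv)

setup_lifting type_definition_Hinf

lemma Hinf_setI:
  assumes "holomorphic_Cn_on f (ball 0 1)" "\<And>z. z \<in> ball 0 1 \<Longrightarrow> norm (f z) \<le> B"
    "\<And>z. z \<notin> ball 0 1 \<Longrightarrow> f z = 0"
  shows "f \<in> Hinf_set"
  using assms unfolding Hinf_set_def bounded_iff by (auto intro!: exI[of _ B])

lemma Hinf_setE:
  assumes "f \<in> Hinf_set"
  obtains B where "holomorphic_Cn_on f (ball 0 1)" "\<And>z. norm (f z) \<le> B"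
    "\<And>z. z \<notin> ball 0 1 \<Longrightarrow> f z = 0"
proof -
  obtain B where "\<And>z. z \<in> ball 0 1 \<Longrightarrow> norm (f z) \<le> B"
    using assms unfolding Hinf_set_def bounded_iff by blast
  then have "norm (f z) \<le> max B 0" for z
    using assms unfolding Hinf_set_def by (cases "z \<in> ball 0 1") (auto simp: le_max_iff_disj)
  then show ?thesis using that assms unfolding Hinf_set_def by blast
qed

lemma Hinf_eqI: "(\<And>z. z \<in> ball 0 1 \<Longrightarrow> apply_Hinf f z = apply_Hinf g z) \<Longrightarrow> f = g"
  by transfer (fastforce simp: Hinf_set_def)

lemma apply_Hinf_outside: "z \<notin> ball 0 1 \<Longrightarrow> apply_Hinf f z = 0"
  by transfer (simp add: Hinf_set_def)

lemma holomorphic_apply_Hinf: "holomorphic_Cn_on (apply_Hinf f) (ball 0 1)"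
  by transfer (simp add: Hinf_set_def)

lemma bounded_apply_Hinf: "bounded (apply_Hinf f ` ball 0 1)"
  by transfer (simp add: Hinf_set_def)

instantiation Hinf :: (finite) real_vector
begin

lift_definition zero_Hinf :: "'a Hinf" is "\<lambda>_. 0"
  by (rule Hinf_setI[where B = 0]) (auto simp: holomorphic_Cn_on_const)

lift_definition plus_Hinf :: "'a Hinf \<Rightarrow> 'a Hinf \<Rightarrow> 'a Hinf" is "\<lambda>f g z. f z + g z"
proof -
  fix f g :: "complex^'a \<Rightarrow> complex"
  assume "f \<in> Hinf_set" "g \<in> Hinf_set"
  then show "(\<lambda>z. f z + g z) \<in> Hinf_set"
    by (elim Hinf_setE, intro Hinf_setI[where B = "_ + _"])
       (auto intro: holomorphic_Cn_on_add norm_triangle_mono)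
qed

lift_definition uminus_Hinf :: "'a Hinf \<Rightarrow> 'a Hinf" is "\<lambda>f z. - f z"
  by (elim Hinf_setE, rule Hinf_setI) (auto intro: holomorphic_Cn_on_minus)

lift_definition minus_Hinf :: "'a Hinf \<Rightarrow> 'a Hinf \<Rightarrow> 'a Hinf" is "\<lambda>f g z. f z - g z"
proof -
  fix f g :: "complex^'a \<Rightarrow> complex"
  assume "f \<in> Hinf_set" "g \<in> Hinf_set"
  then show "(\<lambda>z. f z - g z) \<in> Hinf_set"
    by (elim Hinf_setE, intro Hinf_setI[where B = "_ + _"])
       (auto intro: holomorphic_Cn_on_diff order_trans[OF norm_triangle_ineq4 add_mono])
qed

lift_definition scaleR_Hinf :: "real \<Rightarrow> 'a Hinf \<Rightarrow> 'a Hinf" is "\<lambda>r f z. r *\<^sub>R f z"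
proof -
  fix r :: real and f :: "complex^'a \<Rightarrow> complex"
  assume "f \<in> Hinf_set"
  then obtain B where "holomorphic_Cn_on f (ball 0 1)" "\<And>z. norm (f z) \<le> B"
    "\<And>z. z \<notin> ball 0 1 \<Longrightarrow> f z = 0"
    by (rule Hinf_setE) blast
  then show "(\<lambda>z. r *\<^sub>R f z) \<in> Hinf_set"
    by (intro Hinf_setI[where B = "\<bar>r\<bar> * B"])
       (auto intro: holomorphic_Cn_on_scaleR mult_left_mono)
qed

lemmas [simp] = zero_Hinf.rep_eq plus_Hinf.rep_eq uminus_Hinf.rep_eq minus_Hinf.rep_eq
  scaleR_Hinf.rep_eq

instance
  by standard (auto intro!: Hinf_eqI simp: algebra_simps)

end

instantiation Hinf :: (finite) real_normed_vector
begin

definition norm_Hinf :: "'a Hinf \<Rightarrow> real" where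
  "norm_Hinf f = (SUP z\<in>ball 0 1. norm (apply_Hinf f z))"

definition dist_Hinf :: "'a Hinf \<Rightarrow> 'a Hinf \<Rightarrow> real" where
  "dist_Hinf f g = norm (f - g)"

definition sgn_Hinf :: "'a Hinf \<Rightarrow> 'a Hinf" where
  "sgn_Hinf f = f /\<^sub>R norm f"

definition uniformity_Hinf :: "('a Hinf \<times> 'a Hinf) filter" where
  "uniformity_Hinf = (INF e\<in>{0 <..}. principal {(x, y). dist x y < e})"

definition open_Hinf :: "'a Hinf set \<Rightarrow> bool" where
  "open_Hinf S = (\<forall>x\<in>S. \<forall>\<^sub>F (x', y) in uniformity. x' = x \<longrightarrow> y \<in> S)"

lemma norm_apply_Hinf_le_aux:
  assumes "z \<in> ball 0 1" shows "norm (apply_Hinf f z) \<le> norm f"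
  unfolding norm_Hinf_def
proof (rule cSUP_upper[OF assms])
  show "bdd_above ((\<lambda>z. norm (apply_Hinf f z)) ` ball 0 1)"
    using bounded_apply_Hinf[of f] unfolding bounded_iff bdd_above_def by auto
qed

lemma norm_Hinf_le: "(\<And>z. z \<in> ball 0 1 \<Longrightarrow> norm (apply_Hinf f z) \<le> b) \<Longrightarrow> norm f \<le> b"
  unfolding norm_Hinf_def by (rule cSUP_least) auto

lemma norm_Hinf_nonneg: "norm (f :: 'a Hinf) \<ge> 0"
  by (rule order_trans[OF norm_ge_zero norm_apply_Hinf_le_aux[of 0 f]]) simp

lemma norm_Hinf_scaleR_le: "norm (a *\<^sub>R f) \<le> \<bar>a\<bar> * norm (f :: 'a Hinf)"
  by (rule norm_Hinf_le) (simp add: mult_left_mono norm_apply_Hinf_le_aux)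

instance
proof
  fix a :: real and f g :: "'a Hinf"
  show "norm f = 0 \<longleftrightarrow> f = 0"
  proof
    assume "norm f = 0"
    then show "f = 0"
      using norm_apply_Hinf_le_aux[of _ f] by (intro Hinf_eqI) simp
  next
    assume "f = 0"
    then show "norm f = 0" using norm_Hinf_le[of f 0] norm_Hinf_nonneg[of f] by simp
  qed
  show "norm (f + g) \<le> norm f + norm g"
    by (rule norm_Hinf_le) (auto intro!: norm_triangle_mono norm_apply_Hinf_le_aux)
  show "norm (a *\<^sub>R f) = \<bar>a\<bar> * norm f"
  proof (cases "a = 0")
    case True
    then show ?thesis using norm_Hinf_scaleR_le[of a f] norm_Hinf_nonneg[of "a *\<^sub>R f"] by simp
  next
    case False
    have "norm f \<le> \<bar>inverse a\<bar> * norm (a *\<^sub>R f)"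
      using norm_Hinf_scaleR_le[of "inverse a" "a *\<^sub>R f"] False by simp
    then have "\<bar>a\<bar> * norm f \<le> norm (a *\<^sub>R f)"
      using False by (simp add: field_simps abs_inverse)
    then show ?thesis using norm_Hinf_scaleR_le[of a f] by simp
  qed
qed (rule dist_Hinf_def sgn_Hinf_def uniformity_Hinf_def open_Hinf_def)+

end

lemma norm_apply_Hinf_le: "norm (apply_Hinf f z) \<le> norm f"
  by (cases "z \<in> ball 0 1") (auto simp: norm_apply_Hinf_le_aux apply_Hinf_outside)

instance Hinf :: (finite) banach
proof
  fix F :: "nat \<Rightarrow> 'a Hinf"
  assume C: "Cauchy F"
  have "\<exists>N. \<forall>m\<ge>N. \<forall>n\<ge>N. \<forall>z. dist (apply_Hinf (F m) z) (apply_Hinf (F n) z) < e"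
    if e: "e > 0" for e
  proof -
    obtain N where N: "\<forall>m\<ge>N. \<forall>n\<ge>N. norm (F m - F n) < e"
      using CauchyD[OF C e] by blast
    have "dist (apply_Hinf (F m) z) (apply_Hinf (F n) z) \<le> norm (F m - F n)" for m n z
      using norm_apply_Hinf_le[of "F m - F n" z] by (simp add: dist_norm)
    then have "dist (apply_Hinf (F m) z) (apply_Hinf (F n) z) < e" if "m \<ge> N" "n \<ge> N" for m n z
      using N that order_le_less_trans by blast
    then show ?thesis by blast
  qed
  then have "\<forall>e>0. \<exists>N. \<forall>m n z. N \<le> m \<and> N \<le> n \<and> True \<longrightarrow>
      dist (apply_Hinf (F m) z) (apply_Hinf (F n) z) < e"
    by blast
  from this[folded uniformly_convergent_eq_cauchy] obtain l
    where "\<forall>e>0. \<exists>N. \<forall>n z. N \<le> n \<and> True \<longrightarrow> dist (apply_Hinf (F n) z) (l z) < e" ..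
  then have l: "\<exists>N. \<forall>n\<ge>N. \<forall>z. dist (apply_Hinf (F n) z) (l z) < e" if "e > 0" for e
    using that by blast
  then have ul: "uniform_limit X (\<lambda>n. apply_Hinf (F n)) l sequentially" for X
    unfolding uniform_limit_sequentially_iff by blast
  have "l \<in> Hinf_set"
  proof -
    obtain N where N: "\<And>n z. n \<ge> N \<Longrightarrow> dist (apply_Hinf (F n) z) (l z) < 1"
      using l[of 1] by auto
    show ?thesis
    proof (rule Hinf_setI)
      show "holomorphic_Cn_on l (ball 0 1)"
        by (rule holomorphic_Cn_on_uniform_limit[OF holomorphic_apply_Hinf open_ball ul])
      show "norm (l z) \<le> norm (F N) + 1" for z
        using N[of N z] norm_apply_Hinf_le[of "F N" z]
          norm_triangle_ineq2[of "l z" "apply_Hinf (F N) z"]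
        by (simp add: dist_norm norm_minus_commute)
      fix z :: "complex^'a" assume "z \<notin> ball 0 1"
      then have "(\<lambda>n. apply_Hinf (F n) z) = (\<lambda>_. 0)" by (simp add: apply_Hinf_outside)
      moreover have "(\<lambda>n. apply_Hinf (F n) z) \<longlonglongrightarrow> l z"
        using tendsto_uniform_limitI[OF ul[of UNIV]] by simp
      ultimately show "l z = 0" by (simp add: LIMSEQ_const_iff)
    qed
  qed
  then obtain L where L: "apply_Hinf L = l" using Abs_Hinf_inverse by blast
  have "F \<longlonglongrightarrow> L"
  proof (rule LIMSEQ_I)
    fix e :: real assume "e > 0"
    then obtain N where N: "\<And>n z. n \<ge> N \<Longrightarrow> dist (apply_Hinf (F n) z) (l z) < e / 2"
      using l[of "e / 2"] by auto
    have "norm (F n - L) \<le> e / 2" if "n \<ge> N" for n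
      using N[OF that] by (intro norm_Hinf_le) (simp add: L dist_norm less_imp_le)
    then show "\<exists>N. \<forall>n\<ge>N. norm (F n - L) < e"
      using \<open>e > 0\<close> by (intro exI[of _ N]) force
  qed
  then show "convergent F" by (rule convergentI)
qed


section \<open>Composition operators\<close>

text \<open>
  The composition operator \<open>f \<mapsto> f \<circ> \<phi>\<close>. It has the intended meaning whenever \<open>\<phi>\<close> is a
  holomorphic self-map of the ball; for other \<open>\<phi>\<close> its value is irrelevant. The lemma
  \<open>apply_composition_operator\<close> below confirms this for linear self-maps.
\<close>

definition composition_operator :: "(complex^'n \<Rightarrow> complex^'n) \<Rightarrow> 'n::finite Hinf \<Rightarrow>\<^sub>L 'n Hinf" where
  "composition_operator \<phi> =
     Blinfun (\<lambda>f. Abs_Hinf (\<lambda>z. if z \<in> ball 0 1 then apply_Hinf f (\<phi> z) else 0))"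

lemma matrix_self_map_ball:
  fixes A :: "complex^'n^'n"
  assumes "(SUP z\<in>ball 0 1. norm (A *v z)) \<le> 1" "z \<in> ball 0 1"
  shows "A *v z \<in> ball 0 1"
proof (cases "z = 0")
  case True
  then show ?thesis by simp
next
  case False
  have bl: "bounded_linear ((*v) A)" by (simp add: matrix_vector_mul_bounded_linear)
  have bdd: "bdd_above ((\<lambda>z. norm (A *v z)) ` ball 0 1)"
  proof (rule bdd_aboveI2)
    fix w :: "complex^'n" assume w: "w \<in> ball 0 1"
    have "norm (A *v w) \<le> onorm ((*v) A) * norm w" by (rule onorm[OF bl])
    also have "\<dots> \<le> onorm ((*v) A) * 1"
      using w onorm_pos_le[OF bl] by (intro mult_left_mono) auto
    finally show "norm (A *v w) \<le> onorm ((*v) A) * 1" .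
  qed
  have le: "norm (A *v w) \<le> 1" if "w \<in> ball 0 1" for w
    using cSUP_upper[OF that bdd] assms(1) by linarith
  obtain s where s: "norm z < s" "s < 1" using assms(2) dense[of "norm z" 1] by auto
  have s0: "s > 0" using s norm_ge_zero[of z] by linarith
  have "norm (A *v ((1 / s) *\<^sub>R z)) \<le> 1" using s s0 by (intro le) (simp add: field_simps)
  moreover have "A *v ((1 / s) *\<^sub>R z) = (1 / s) *\<^sub>R (A *v z)"
    using linear_scale[OF bounded_linear.linear[OF bl]] .
  ultimately have "norm (A *v z) \<le> s" using s0 by (simp add: field_simps)
  then show ?thesis using s by simp
qed

lemma apply_composition_operator:
  fixes A :: "complex^'n^'n"
  assumes "(SUP z\<in>ball 0 1. norm (A *v z)) \<le> 1" "z \<in> ball 0 1"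
  shows "apply_Hinf (blinfun_apply (composition_operator (\<lambda>z. A *v z)) f) z = apply_Hinf f (A *v z)"
proof -
  define c where "c = (\<lambda>f z. if z \<in> ball 0 1 then apply_Hinf f (A *v z) else 0)"
  note self = matrix_self_map_ball[OF assms(1)]
  have mem: "c f \<in> Hinf_set" for f
  proof (rule Hinf_setI)
    show "holomorphic_Cn_on (c f) (ball 0 1)"
      by (rule holomorphic_Cn_on_cong[OF open_ball _ holomorphic_Cn_on_compose_linear[
            OF holomorphic_apply_Hinf[of f] self]]) (auto simp: c_def)
    show "norm (c f z) \<le> norm f" for z by (simp add: c_def norm_apply_Hinf_le)
  qed (simp add: c_def)
  have ap: "apply_Hinf (Abs_Hinf (c f)) z = c f z" for f z
    by (simp add: Abs_Hinf_inverse mem)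
  have "bounded_linear (\<lambda>f. Abs_Hinf (c f))"
  proof (rule bounded_linear_intro[where K = 1])
    show "norm (Abs_Hinf (c f)) \<le> norm f * 1" for f
      by (rule norm_Hinf_le) (simp add: ap, simp add: c_def norm_apply_Hinf_le)
  qed (auto intro!: Hinf_eqI simp: ap, auto simp: c_def)
  then show ?thesis
    using assms(2) ap unfolding composition_operator_def c_def
    by (simp add: bounded_linear_Blinfun_apply)
qed


section \<open>Mean ergodicity\<close>

text \<open>
  Bounded operators are the library's real-linear ones. If the powers of \<open>T\<close> are complex-linear,
  then so is every strong or norm limit of the means, so nothing changes in the complex setting.
\<close>

definition cesaro_mean :: "('a::real_normed_vector \<Rightarrow>\<^sub>L 'a) \<Rightarrow> nat \<Rightarrow> 'a \<Rightarrow>\<^sub>L 'a" where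
  "cesaro_mean T j = (1 / real j) *\<^sub>R (\<Sum>i=1..j. ((\<lambda>S. T o\<^sub>L S) ^^ i) id_blinfun)"

definition mean_ergodic :: "('a::banach \<Rightarrow>\<^sub>L 'a) \<Rightarrow> bool" where
  "mean_ergodic T \<longleftrightarrow>
     (\<exists>P :: 'a \<Rightarrow>\<^sub>L 'a. \<forall>x. (\<lambda>j. blinfun_apply (cesaro_mean T j) x) \<longlonglongrightarrow> blinfun_apply P x)"

definition uniformly_mean_ergodic :: "('a::banach \<Rightarrow>\<^sub>L 'a) \<Rightarrow> bool" where
  "uniformly_mean_ergodic T \<longleftrightarrow> (\<exists>P :: 'a \<Rightarrow>\<^sub>L 'a. cesaro_mean T \<longlonglongrightarrow> P)"


section \<open>Eigenvalues\<close>

definition eigenvalues :: "complex^'n^'n \<Rightarrow> complex set" where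
  "eigenvalues A = {c. \<exists>v. v \<noteq> 0 \<and> A *v v = c *s v}"

definition root_of_one :: "complex \<Rightarrow> bool" where
  "root_of_one c \<longleftrightarrow> (\<exists>m::nat. m \<ge> 1 \<and> c ^ m = 1)"

end

theory Submission
  imports Defs "HOL-Computational_Algebra.Fundamental_Theorem_Algebra"
begin

text \<open>
  A contraction splits the space orthogonally into the part on which all its powers are isometric
  and a part on which they decay geometrically. If the unimodular eigenvalues are roots of \<open>1\<close>, the
  isometric part is periodic of some period \<open>N\<close>, and the Schwarz lemma on the complex lines in the
  decaying directions shows that \<open>C\<^sub>A\<^bsup>i+N\<^esup> - C\<^sub>A\<^bsup>i\<^esup>\<close> is summable in norm, so the means converge in norm.
  Conversely, a unimodular eigenvalue \<open>c\<close> of \<open>A\<close> with unit eigenvector \<open>v\<close> satisfies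
  \<open>\<langle>A z, v\<rangle> = c \<langle>z, v\<rangle>\<close>, which embeds the rotation by \<open>c\<close> on the disc into \<open>C\<^sub>A\<close>. If \<open>c\<close> is not a root
  of \<open>1\<close>, a uniform limit of the rotation means of \<open>h\<close> can only be the constant \<open>h 0\<close>; this fails
  for a singular inner function \<open>h\<close> that is tiny on arbitrarily long orbit segments.
\<close>

section \<open>Means of asymptotically periodic sequences\<close>

text \<open>Raising the shift by one changes the sum only by the boundary terms
  \<open>x (Suc j + r) - x (1 + r)\<close>, which are at most \<open>2 * B\<close> in norm and
  vanish after division by \<open>j\<close>.\<close>

lemma bounded_shift_mean_tendsto:
  fixes x :: "nat \<Rightarrow> 'a::real_normed_vector"
  assumes "\<And>i. norm (x i) \<le> B"
  shows "(\<lambda>j. (1 / real j) *\<^sub>R (\<Sum>i=1..j. x (i + r) - x i)) \<longlonglongrightarrow> 0"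
proof (induction r)
  case (Suc r)
  have "(\<lambda>j. (1 / real j) *\<^sub>R (x (Suc j + r) - x (1 + r))) \<longlonglongrightarrow> 0"
  proof (rule Lim_null_comparison)
    show "\<forall>\<^sub>F j in sequentially. norm ((1 / real j) *\<^sub>R (x (Suc j + r) - x (1 + r))) \<le> (2 * B) * (1 / real j)"
    proof (rule eventuallyI)
      fix j
      have "norm (x (Suc j + r) - x (1 + r)) \<le> 2 * B"
        using norm_triangle_ineq4[of "x (Suc j + r)" "x (1 + r)"] assms[of "Suc j + r"] assms[of "1 + r"]
        by linarith
      then show "norm ((1 / real j) *\<^sub>R (x (Suc j + r) - x (1 + r))) \<le> (2 * B) * (1 / real j)"
        by (simp add: divide_right_mono)
    qed
    show "(\<lambda>j. (2 * B) * (1 / real j)) \<longlonglongrightarrow> 0"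
      by (intro tendsto_mult_right_zero lim_1_over_n)
  qed
  from tendsto_add[OF this Suc]
  have "(\<lambda>j. (1 / real j) *\<^sub>R (x (Suc j + r) - x (1 + r) + (\<Sum>i=1..j. x (i + r) - x i))) \<longlonglongrightarrow> 0"
    by (simp add: scaleR_add_right)
  moreover have "x (Suc j + r) - x (1 + r) + (\<Sum>i=1..j. x (i + r) - x i) = (\<Sum>i=1..j. x (i + Suc r) - x i)" for j
    by (induction j) (simp_all add: algebra_simps)
  ultimately show ?case by simp
qed simp

lemma mean_tendsto_zero:
  fixes x :: "nat \<Rightarrow> 'a::real_normed_vector"
  assumes "x \<longlonglongrightarrow> 0"
  shows "(\<lambda>j. (1 / real j) *\<^sub>R (\<Sum>i=1..j. x i)) \<longlonglongrightarrow> 0"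
proof (rule LIMSEQ_I)
  fix e :: real assume e: "e > 0"
  obtain N where N: "\<And>i. i \<ge> N \<Longrightarrow> norm (x i) < e / 2"
    using LIMSEQ_D[OF assms, of "e / 2"] e by auto
  define C where "C = (\<Sum>i=1..N. norm (x i))"
  have C: "C \<ge> 0" by (simp add: C_def sum_nonneg)
  \<comment> \<open>Beyond this bound the head \<open>C\<close> of the sum is below
    \<open>j * (e / 2)\<close>, and the tail is at most that as well.\<close>
  obtain M where M: "real M > 2 * C / e" using reals_Archimedean2 by blast
  have "norm ((1 / real j) *\<^sub>R (\<Sum>i=1..j. x i)) < e" if j: "j \<ge> max (Suc N) M" for j
  proof -
    have "norm (\<Sum>i=1..j. x i) \<le> (\<Sum>i=1..j. norm (x i))" by (rule norm_sum)
    also have "\<dots> = C + (\<Sum>i\<in>{Suc N..j}. norm (x i))"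
    proof -
      have "N + (j - N) = j" using j by simp
      then show ?thesis
        using sum.ub_add_nat[of 1 N "\<lambda>i. norm (x i)" "j - N"] by (simp add: C_def)
    qed
    also have "(\<Sum>i\<in>{Suc N..j}. norm (x i)) \<le> (\<Sum>i\<in>{Suc N..j}. e / 2)"
      using N by (intro sum_mono less_imp_le) auto
    also have "\<dots> \<le> real j * (e / 2)" using e by (simp add: mult_right_mono)
    finally have *: "norm (\<Sum>i=1..j. x i) \<le> C + real j * (e / 2)" by simp
    have "2 * C / e < real j" using M j by linarith
    then have "C < real j * (e / 2)" using e by (simp add: field_simps)
    then show ?thesis using * j by (simp add: field_simps)
  qed
  then show "\<exists>M. \<forall>j\<ge>M. norm ((1 / real j) *\<^sub>R (\<Sum>i=1..j. x i) - 0) < e"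
    by (metis diff_zero)
qed

text \<open>The block sums \<open>x\<^sub>i + \<dots> + x\<^bsub>i+N-1\<^esub>\<close> have summable increments, and up to a vanishing error their
  means are \<open>N\<close> times those of \<open>x\<close>.\<close>

lemma asymptotically_periodic_mean_convergent:
  fixes x :: "nat \<Rightarrow> 'a::banach"
  assumes bnd: "\<And>i. norm (x i) \<le> B" and N: "N \<ge> 1"
    and sm: "summable (\<lambda>i. norm (x (i + N) - x i))"
  shows "convergent (\<lambda>j. (1 / real j) *\<^sub>R (\<Sum>i=1..j. x i))"
proof -
  define D where "D = (\<lambda>i. \<Sum>r<N. x (i + r))"
  \<comment> \<open>Moving the block by one gains \<open>x (n + N)\<close> and loses
    \<open>x n\<close>.\<close>
  have D: "D n - D 0 = (\<Sum>i<n. x (i + N) - x i)" for n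
  proof (induction n)
    case (Suc n)
    have "D (Suc n) + x n = x n + (\<Sum>r<N. x (n + Suc r))" by (simp add: D_def)
    also have "\<dots> = (\<Sum>r<Suc N. x (n + r))" by (subst sum.lessThan_Suc_shift) simp
    also have "\<dots> = D n + x (n + N)" by (simp add: D_def)
    finally show ?case using Suc by (simp add: algebra_simps)
  qed simp
  have "(\<lambda>n. \<Sum>i<n. x (i + N) - x i) \<longlonglongrightarrow> (\<Sum>i. x (i + N) - x i)"
    by (rule summable_LIMSEQ[OF summable_norm_cancel[OF sm]])
  then have "(\<lambda>n. D n - D 0 + D 0) \<longlonglongrightarrow> (\<Sum>i. x (i + N) - x i) + D 0"
    unfolding D by (intro tendsto_intros)
  then obtain S where "D \<longlonglongrightarrow> S" by auto
  then have "(\<lambda>j. (1 / real j) *\<^sub>R (\<Sum>i=1..j. D i - S)) \<longlonglongrightarrow> 0"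
    by (intro mean_tendsto_zero) (simp add: LIM_zero)
  moreover have "(\<lambda>j. \<Sum>r<N. (1 / real j) *\<^sub>R (\<Sum>i=1..j. x (i + r) - x i)) \<longlonglongrightarrow> (\<Sum>r<N. 0)"
    by (intro tendsto_sum bounded_shift_mean_tendsto[OF bnd])
  ultimately have "(\<lambda>j. S + (1 / real j) *\<^sub>R (\<Sum>i=1..j. D i - S)
      - (\<Sum>r<N. (1 / real j) *\<^sub>R (\<Sum>i=1..j. x (i + r) - x i))) \<longlonglongrightarrow> S + 0 - (\<Sum>r<N. 0)"
    by (intro tendsto_diff tendsto_add tendsto_const)
  then have lim: "(\<lambda>j. (1 / real N) *\<^sub>R (S + (1 / real j) *\<^sub>R (\<Sum>i=1..j. D i - S)
      - (\<Sum>r<N. (1 / real j) *\<^sub>R (\<Sum>i=1..j. x (i + r) - x i)))) \<longlonglongrightarrow> (1 / real N) *\<^sub>R S"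
    by (intro tendsto_scaleR tendsto_const) simp
  \<comment> \<open>Summed over \<open>r < N\<close>, the shift differences are the total of
    \<open>D\<close> minus \<open>N\<close> times the total of \<open>x\<close>. For
    \<open>j \<ge> 1\<close> the mean of the constant \<open>S\<close> is \<open>S\<close>.\<close>
  have eq: "(1 / real N) *\<^sub>R (S + (1 / real j) *\<^sub>R (\<Sum>i=1..j. D i - S)
      - (\<Sum>r<N. (1 / real j) *\<^sub>R (\<Sum>i=1..j. x (i + r) - x i)))
      = (1 / real j) *\<^sub>R (\<Sum>i=1..j. x i)" if j: "j \<ge> 1" for j
  proof -
    have "(\<Sum>r<N. \<Sum>i=1..j. x (i + r) - x i) = (\<Sum>i=1..j. D i) - real N *\<^sub>R (\<Sum>i=1..j. x i)"
      by (subst sum.swap) (simp add: sum_subtractf D_def scaleR_sum_right sum_constant_scaleR)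
    then show ?thesis
      using j N by (simp add: sum_subtractf sum_constant_scaleR scaleR_diff_right flip: scaleR_sum_right)
  qed
  have "(\<lambda>j. (1 / real j) *\<^sub>R (\<Sum>i=1..j. x i)) \<longlonglongrightarrow> (1 / real N) *\<^sub>R S"
    by (rule Lim_transform_eventually[OF lim]) (rule eventually_sequentiallyI[OF eq])
  then show ?thesis by (rule convergentI)
qed

text \<open>With \<open>\<theta>\<close> the \<open>K\<close>-th root of \<open>\<rho>\<close>,
  rounding the exponent down to a multiple of \<open>K\<close> costs at most the factor
  \<open>1 / \<rho>\<close>; a geometric series remains.\<close>

lemma summable_power_div:
  fixes \<rho> :: real
  assumes "0 < \<rho>" "\<rho> < 1" "K \<ge> 1"
  shows "summable (\<lambda>i. \<rho> ^ (i div K))"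
proof -
  define \<theta> where "\<theta> = root K \<rho>"
  have \<theta>: "0 < \<theta>" "\<theta> < 1" "\<theta> ^ K = \<rho>" using assms by (auto simp: \<theta>_def)
  have "\<rho> ^ (i div K) \<le> (1 / \<rho>) * \<theta> ^ i" for i
  proof -
    have "i \<le> K * (i div K) + K"
      using assms(3) mod_less_divisor[of K i] mult_div_mod_eq[of K i] by linarith
    then have "\<theta> ^ (K * (i div K) + K) \<le> \<theta> ^ i"
      using \<theta> by (intro power_decreasing) auto
    then show ?thesis using \<theta> assms by (simp add: power_add power_mult field_simps)
  qed
  then show ?thesis
    using \<theta> assms
    by (intro summable_comparison_test'[OF summable_mult[OF summable_geometric[of \<theta>], of "1 / \<rho>"]]) auto
qed

section \<open>The Schwarz lemma on complex lines\<close>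

text \<open>Restriction to a complex line, where one-variable theorems apply.\<close>

lemma holomorphic_Cn_on_line:
  fixes f :: "complex^'n \<Rightarrow> complex"
  assumes hol: "holomorphic_Cn_on f S" and "open X" and inS: "\<And>t. t \<in> X \<Longrightarrow> a + t *s b \<in> S"
  shows "(\<lambda>t. f (a + t *s b)) holomorphic_on X"
proof -
  have line: "((\<lambda>t. a + t *s b) has_derivative (\<lambda>t. t *s b)) (at t)" for t
    using has_derivative_add[OF has_derivative_const
        bounded_linear_imp_has_derivative[OF bounded_linear_scalar_left]] by simp
  have "\<exists>d. ((\<lambda>t. f (a + t *s b)) has_field_derivative d) (at t)" if t: "t \<in> X" for t
  proof -
    obtain E where E: "(f has_derivative E) (at (a + t *s b))" "\<And>c v. E (c *s v) = c * E v"
      using hol inS[OF t] unfolding holomorphic_Cn_on_def by blast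
    from has_derivative_compose[OF line E(1)]
    have "((\<lambda>t. f (a + t *s b)) has_derivative (\<lambda>s. E b * s)) (at t)"
      by (simp add: E(2) mult.commute)
    then show ?thesis by (auto simp: has_field_derivative_def)
  qed
  then show ?thesis
    by (subst holomorphic_on_open[OF \<open>open X\<close>]) auto
qed

text \<open>On the disc of radius \<open>1 / t\<close>, the function
  \<open>f (a + s b) - f a\<close> of \<open>s\<close> vanishes at 0 and is bounded by
  \<open>2 * norm f\<close>; the Schwarz lemma at \<open>s = 1\<close> gains the factor
  \<open>t\<close>.\<close>

lemma Hinf_Schwarz:
  fixes f :: "'n::finite Hinf"
  assumes t: "0 < t" "t \<le> 1"
    and b: "\<And>s. norm s < 1 / t \<Longrightarrow> a + s *s b \<in> ball 0 1"
  shows "norm (apply_Hinf f (a + b) - apply_Hinf f a) \<le> 3 * t * norm f"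
\<comment> \<open>Treated apart because \<open>norm f\<close> becomes a divisor and \<open>t\<close>
  must lie in the open disc.\<close>
proof (cases "f = 0 \<or> t = 1")
  case True
  have "norm (apply_Hinf f (a + b) - apply_Hinf f a) \<le> norm f + norm f"
    by (rule order_trans[OF norm_triangle_ineq4]) (intro add_mono norm_apply_Hinf_le)
  also have "\<dots> \<le> 3 * t * norm f" using True by auto
  finally show ?thesis .
next
  case False
  then have f: "norm f > 0" and t1: "t < 1" using t by auto
  \<comment> \<open>The disc is rescaled to radius 1, which moves \<open>s = 1\<close> to
    \<open>t\<close>. The constant 3 in place of 2 makes the bound by 1 strict, as the Schwarz lemma
    demands.\<close>
  define g where "g = (\<lambda>s. (apply_Hinf f (a + s *s ((1 / t) *\<^sub>R b)) - apply_Hinf f a) / (3 * norm f))"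
  have inb: "a + s *s ((1 / t) *\<^sub>R b) \<in> ball 0 1" if "norm s < 1" for s
  proof -
    have "s *s ((1 / t) *\<^sub>R b) = (s / t) *s b"
      by (simp add: vec_eq_iff) (simp add: scaleR_conv_of_real)
    moreover have "norm (s / t) < 1 / t" using that t by (simp add: norm_divide divide_strict_right_mono)
    ultimately show ?thesis using b by metis
  qed
  have "norm (g (of_real t)) \<le> norm (complex_of_real t)"
  proof (rule Schwarz_Lemma(1))
    show "g holomorphic_on ball 0 1"
      unfolding g_def using f
      by (intro holomorphic_intros holomorphic_Cn_on_line[OF holomorphic_apply_Hinf]) (use inb in auto)
    show "g 0 = 0" by (simp add: g_def)
    show "norm (complex_of_real t) < 1" using t t1 by simp
    fix s :: complex
    have "norm (apply_Hinf f (a + s *s ((1 / t) *\<^sub>R b)) - apply_Hinf f a) \<le> norm f + norm f"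
      by (rule order_trans[OF norm_triangle_ineq4]) (intro add_mono norm_apply_Hinf_le)
    also have "norm f + norm f < 3 * norm f" using f by simp
    finally show "norm (g s) < 1" using f by (simp add: g_def norm_divide)
  qed
  moreover have "complex_of_real t *s ((1 / t) *\<^sub>R b) = b"
    using t by (simp add: vec_eq_iff) (simp add: scaleR_conv_of_real)
  ultimately show ?thesis
    using f t by (simp add: g_def norm_divide field_simps)
qed

section \<open>Contractive matrices\<close>

text \<open>The vector \<open>p(A) y\<close> by Horner's scheme, so that no matrix powers are
  formed.\<close>

definition matrix_poly :: "complex^'n^'n \<Rightarrow> complex poly \<Rightarrow> complex^'n \<Rightarrow> complex^'n" where
  "matrix_poly A p y = fold_coeffs (\<lambda>a w. a *s y + A *v w) p 0"

lemma matrix_vector_mult_smult: "A *v (c *s v) = c *s (A *v v)" for A :: "complex^'n^'m"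
  by (simp add: vec_eq_iff matrix_vector_mult_def sum_distrib_left algebra_simps)

lemma matrix_poly_0 [simp]: "matrix_poly A 0 y = 0"
  by (simp add: matrix_poly_def)

lemma matrix_poly_pCons [simp]: "matrix_poly A (pCons a p) y = a *s y + A *v matrix_poly A p y"
  by (cases "p = 0"; cases "a = 0") (simp_all add: matrix_poly_def)

lemma matrix_poly_add: "matrix_poly A (p + q) y = matrix_poly A p y + matrix_poly A q y"
  by (induction p q rule: poly_induct2)
     (simp_all add: matrix_vector_right_distrib vector_sadd_rdistrib algebra_simps)

lemma matrix_poly_smult: "matrix_poly A (smult c p) y = c *s matrix_poly A p y"
  by (induction p) (simp_all add: matrix_vector_mult_smult vector_add_ldistrib vector_smult_assoc)

lemma matrix_poly_diff: "matrix_poly A (p - q) y = matrix_poly A p y - matrix_poly A q y"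
  using matrix_poly_add[of A "p - q" q y] by (simp add: algebra_simps)

lemma matrix_poly_sum: "matrix_poly A (sum f I) y = (\<Sum>i\<in>I. matrix_poly A (f i) y)"
  by (induction I rule: infinite_finite_induct) (simp_all add: matrix_poly_add)

lemma matrix_poly_monom: "matrix_poly A (monom c k) y = c *s (((*v) A ^^ k) y)"
  by (induction k) (simp_all add: monom_Suc matrix_vector_mult_smult monom_0)

lemma matrix_poly_linear_factor:
  "matrix_poly A ([:-c, 1:] * q) y = A *v matrix_poly A q y - c *s matrix_poly A q y"
  by (simp add: matrix_poly_diff matrix_poly_smult)

text \<open>\<open>q(A)\<close> commutes with \<open>A - c\<close>. Hence \<open>q\<close>
  annihilates \<open>A y - c y\<close> whenever \<open>(X - c) q\<close> annihilates
  \<open>y\<close>.\<close>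

lemma matrix_poly_shift:
  "matrix_poly A q (A *v y - c *s y) = A *v matrix_poly A q y - c *s matrix_poly A q y"
proof (induction q)
  case (pCons a q)
  have "matrix_poly A (pCons a q) (A *v y - c *s y)
      = a *s (A *v y - c *s y) + A *v (A *v matrix_poly A q y - c *s matrix_poly A q y)"
    using pCons by simp
  then show ?case
    by (simp add: matrix_vector_right_distrib matrix_vector_mult_smult
        matrix_vector_mult_diff_distrib vector_ssub_ldistrib vector_add_ldistrib
        vector_smult_assoc mult.commute)
qed simp

lemma of_real_smult: "complex_of_real r *s x = r *\<^sub>R x"
  by (simp add: vec_eq_iff, simp add: scaleR_conv_of_real)

text \<open>The first \<open>DIM + 1\<close> iterates of \<open>y\<close> are linearly dependent
  over the reals, and a dependence relation is a polynomial.\<close>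

lemma exists_annihilating_poly:
  fixes A :: "complex^'n^'n"
  obtains p where "p \<noteq> 0" "matrix_poly A p y = 0"
proof -
  define w where "w = (\<lambda>i. ((*v) A ^^ i) y)"
  define I where "I = {..DIM(complex^'n)}"
  show thesis
  \<comment> \<open>A repetition among the iterates is treated apart, since the set of iterates
    would hide it.\<close>
  proof (cases "inj_on w I")
    case False
    then obtain i j where ij: "i \<noteq> j" "w i = w j"
      by (auto simp: inj_on_def)
    have "coeff (monom 1 i - monom (1::complex) j) i = 1"
      using ij by simp
    then have "monom 1 i - monom (1::complex) j \<noteq> 0"
      by (metis coeff_0 zero_neq_one)
    moreover have "matrix_poly A (monom 1 i - monom 1 j) y = 0"
      using ij by (simp add: matrix_poly_diff matrix_poly_monom w_def)
    ultimately show ?thesis by (rule that)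
  next
    case True
    have "dependent (w ` I)"
      by (rule dependent_biggerset) (simp add: card_image[OF True], simp add: I_def)
    then obtain u i where u: "i \<in> I" "u (w i) \<noteq> (0::real)" "(\<Sum>v\<in>w ` I. u v *\<^sub>R v) = 0"
      by (subst (asm) real_vector.dependent_finite) (auto simp: I_def)
    define p where "p = (\<Sum>i\<in>I. monom (complex_of_real (u (w i))) i)"
    have "coeff p i = u (w i)"
      using u(1) by (simp add: p_def coeff_sum I_def)
    then have "p \<noteq> 0" using u(2) by auto
    moreover have "matrix_poly A p y = (\<Sum>i\<in>I. u (w i) *\<^sub>R w i)"
      by (simp add: p_def matrix_poly_sum matrix_poly_monom w_def of_real_smult)
    then have "matrix_poly A p y = 0"
      using u(3) by (simp add: sum.reindex[OF True])
    ultimately show ?thesis by (rule that)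
  qed
qed

lemma inner_smult_left_complex: "inner (c *s x) y = inner x (cnj c *s y)" for x y :: "complex^'n"
  by (simp add: inner_vec_def inner_complex_def algebra_simps)

text \<open>The norm hypothesis in homogeneous form, which can be iterated at once;
  \<open>matrix_contraction_iff_SUP\<close> identifies the two.\<close>

locale matrix_contraction =
  fixes A :: "complex^'n^'n"
  assumes contraction: "norm (A *v z) \<le> norm z"
begin

abbreviation T :: "complex^'n \<Rightarrow> complex^'n" where "T \<equiv> (*v) A"

lemma bounded_linear_power: "bounded_linear (T ^^ k)"
proof (induction k)
  case 0
  show ?case by (simp add: bounded_linear_ident id_def)
next
  case (Suc k)
  have "bounded_linear (\<lambda>x. T ((T ^^ k) x))"
    by (rule bounded_linear_compose[OF _ Suc]) (simp add: matrix_vector_mul_bounded_linear)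
  then show ?case by (simp add: o_def)
qed

lemmas linear_power = bounded_linear.linear[OF bounded_linear_power]

lemma power_smult: "(T ^^ k) (c *s x) = c *s (T ^^ k) x"
  by (induction k) (simp_all add: matrix_vector_mult_smult)

lemma contraction_power: "norm ((T ^^ k) z) \<le> norm z"
  by (induction k) (auto intro: order_trans[OF contraction])

lemma contraction_power_antimono: "j \<le> k \<Longrightarrow> norm ((T ^^ k) z) \<le> norm ((T ^^ j) z)"
  using contraction_power[of "k - j" "(T ^^ j) z"] by (simp flip: funpow_add[THEN fun_cong, unfolded o_def])

text \<open>The form \<open>|z|\<^sup>2 - |T\<^sup>k z|\<^sup>2\<close> is positive semidefinite, so each of its null vectors is
  orthogonal to everything in its polar form.\<close>

lemma inner_power_eq:
  assumes "norm ((T ^^ k) x) = norm x"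
  shows "inner ((T ^^ k) x) ((T ^^ k) y) = inner x y"
proof -
  interpret L: linear "T ^^ k" by (rule linear_power)
  define b where "b = inner x y - inner ((T ^^ k) x) ((T ^^ k) y)"
  define q where "q = (norm y)\<^sup>2 - (norm ((T ^^ k) y))\<^sup>2"
  \<comment> \<open>The form at \<open>x + t y\<close>; its constant term vanishes because
    \<open>T ^^ k\<close> preserves the norm of \<open>x\<close>.\<close>
  have quad: "2 * t * b + t\<^sup>2 * q \<ge> 0" for t
  proof -
    have "(norm ((T ^^ k) (x + t *\<^sub>R y)))\<^sup>2 \<le> (norm (x + t *\<^sub>R y))\<^sup>2"
      by (intro power_mono contraction_power norm_ge_zero)
    moreover have "(norm ((T ^^ k) x))\<^sup>2 = (norm x)\<^sup>2" using assms by simp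
    ultimately show ?thesis
      unfolding b_def q_def L.add L.scale power2_norm_eq_inner
      by (simp add: inner_add_left inner_add_right inner_commute power2_eq_square algebra_simps)
  qed
  have "b = 0"
  proof (rule ccontr)
    assume "b \<noteq> 0"
    have q: "q \<ge> 0" using contraction_power[of k y] by (simp add: q_def)
    \<comment> \<open>A nonzero linear coefficient forces a negative value at this \<open>t\<close>;
      the \<open>+ 1\<close> keeps the denominator positive when \<open>q = 0\<close>.\<close>
    define t where "t = - b / (q + 1)"
    have "b = - t * (q + 1)"
      using q by (simp add: t_def)
    then have "2 * t * b + t\<^sup>2 * q = t\<^sup>2 * (- q - 2)"
      by (simp only:) (simp add: power2_eq_square algebra_simps)
    also have "\<dots> < 0"
      using q \<open>b \<noteq> 0\<close> by (intro mult_pos_neg) (auto simp: t_def)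
    finally show False using quad[of t] by simp
  qed
  then show ?thesis by (simp add: b_def)
qed

section \<open>The subspace on which all powers are isometric, and its period\<close>

definition isometric_part :: "(complex^'n) set" where
  "isometric_part = {x. \<forall>k. norm ((T ^^ k) x) = norm x}"

text \<open>Norm preservation survives sums because \<open>inner_power_eq\<close> also preserves the
  mixed inner product.\<close>

lemma subspace_isometric_part: "subspace isometric_part"
proof (rule subspaceI)
  fix x y c assume xy: "x \<in> isometric_part" "y \<in> isometric_part"
  have "norm ((T ^^ k) (x + y)) = norm (x + y)" for k
  proof -
    have "inner ((T ^^ k) (x + y)) ((T ^^ k) (x + y)) = inner (x + y) (x + y)"
      using xy inner_power_eq[of k x y] inner_power_eq[of k x x] inner_power_eq[of k y y]
      unfolding linear_add[OF linear_power] isometric_part_def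
      by (simp add: inner_add_left inner_add_right inner_commute)
    then show ?thesis by (simp add: norm_eq_sqrt_inner)
  qed
  then show "x + y \<in> isometric_part" by (simp add: isometric_part_def)
  show "c *\<^sub>R x \<in> isometric_part"
    using xy by (simp add: isometric_part_def linear_scale[OF linear_power])
qed (simp add: isometric_part_def linear_0[OF linear_power])

lemma isometric_part_smult: "x \<in> isometric_part \<Longrightarrow> c *s x \<in> isometric_part"
  by (simp add: isometric_part_def power_smult norm_scalar_vector)

lemma isometric_part_power: "x \<in> isometric_part \<Longrightarrow> (T ^^ k) x \<in> isometric_part"
  by (simp add: isometric_part_def flip: funpow_add[THEN fun_cong, unfolded o_def])

lemma isometric_part_matrix_poly:
  assumes "x \<in> isometric_part" shows "matrix_poly A p x \<in> isometric_part"
proof (induction p)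
  case 0
  then show ?case using subspace_0[OF subspace_isometric_part] by simp
next
  case (pCons a p)
  then show ?case
    using isometric_part_power[of "matrix_poly A p x" 1] isometric_part_smult[OF assms, of a]
    by (auto intro: subspace_add[OF subspace_isometric_part])
qed

lemma power_multiple_fixed: "(T ^^ k) x = x \<Longrightarrow> (T ^^ (k * j)) x = x"
  by (induction j) (simp_all add: funpow_add)

text \<open>If \<open>T\<^sup>L y = y + d\<close> with \<open>d\<close> fixed by \<open>T\<^sup>L\<close>, then \<open>T\<^sup>L\<^sup>j y = y + j d\<close> is bounded in \<open>j\<close>
  only if \<open>d = 0\<close>: this excludes nontrivial Jordan blocks.\<close>

lemma fixed_of_bounded_orbit:
  assumes "(T ^^ L) ((T ^^ L) y - y) = (T ^^ L) y - y"
  shows "(T ^^ L) y = y"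
proof -
  define d where "d = (T ^^ L) y - y"
  have Td: "(T ^^ L) d = d" using assms by (simp add: d_def)
  have orb: "(T ^^ (L * j)) y = y + real j *\<^sub>R d" for j
  proof (induction j)
    case (Suc j)
    have "(T ^^ (L * Suc j)) y = (T ^^ L) (y + real j *\<^sub>R d)"
      using Suc by (simp add: funpow_add)
    also have "\<dots> = (T ^^ L) y + real j *\<^sub>R d"
      by (simp add: linear_add[OF linear_power] linear_scale[OF linear_power] Td)
    also have "(T ^^ L) y = y + d" by (simp add: d_def)
    finally show ?case by (simp add: algebra_simps)
  qed simp
  have "d = 0"
  proof (rule ccontr)
    assume "d \<noteq> 0"
    then obtain j :: nat where j: "2 * norm y < real j * norm d"
      using ex_less_of_nat_mult[of "norm d" "2 * norm y"] by auto
    have "norm (real j *\<^sub>R d) = norm ((T ^^ (L * j)) y - y)" by (simp add: orb)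
    also have "\<dots> \<le> norm y + norm y"
      by (rule order_trans[OF norm_triangle_ineq4]) (simp add: contraction_power)
    finally show False using j by simp
  qed
  then show ?thesis by (simp add: d_def)
qed

lemma norm_eigenvalue_le_1:
  assumes "A *v v = c *s v" "v \<noteq> 0"
  shows "norm c \<le> 1"
  using contraction[of v] assms by (simp add: norm_scalar_vector)

text \<open>Induction on the degree of \<open>p = (X - c) q\<close>. Either \<open>q\<close> already
  annihilates \<open>y\<close>, or \<open>q(A) y\<close> is an isometric eigenvector, so that
  \<open>c\<close> is a root of 1. In the latter case \<open>u = A y - c y\<close> is annihilated by
  \<open>q\<close>, hence periodic, and \<open>fixed_of_bounded_orbit\<close> passes from
  \<open>u\<close> to \<open>y\<close>.\<close>

lemma isometric_part_periodic_vector: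
  assumes roots: "\<And>c. c \<in> eigenvalues A \<Longrightarrow> norm c = 1 \<Longrightarrow> root_of_one c"
    and "y \<in> isometric_part" "p \<noteq> 0" "matrix_poly A p y = 0"
  shows "\<exists>N\<ge>1. (T ^^ N) y = y"
  using assms(2-)
proof (induction "degree p" arbitrary: p y)
  case 0
  then obtain a where "p = [:a:]" "a \<noteq> 0" by (metis degree_eq_zeroE pCons_0_0)
  then have "y = 0" using "0.prems"(3) by (simp add: vec_eq_iff)
  then show ?case by (intro exI[of _ 1]) simp
next
  case (Suc m)
  have "\<exists>c. poly p c = 0"
    using Suc.hyps(2) by (intro fundamental_theorem_of_algebra) (simp add: constant_degree)
  then obtain c q where p: "p = [:-c, 1:] * q"
    by (metis poly_eq_0_iff_dvd dvdE)
  then have q: "q \<noteq> 0" "m = degree q"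
    using Suc.prems(2) Suc.hyps(2) by (auto simp del: mult_pCons_left simp: degree_mult_eq)
  define w where "w = matrix_poly A q y"
  define u where "u = T y - c *s y"
  have Tw: "T w = c *s w"
    using Suc.prems(3) by (simp add: p w_def matrix_poly_linear_factor del: mult_pCons_left)
  have Ty: "T y \<in> isometric_part" using isometric_part_power[OF Suc.prems(1), of 1] by simp
  have u: "u \<in> isometric_part"
    unfolding u_def by (intro subspace_diff[OF subspace_isometric_part] Ty isometric_part_smult Suc.prems)
  have qu: "matrix_poly A q u = 0"
    using Tw by (simp add: u_def w_def matrix_poly_shift)
  show ?case
  proof (cases "w = 0")
    case True
    then show ?thesis using Suc.hyps(1)[OF q(2) Suc.prems(1) q(1)] by (simp add: w_def)
  next
    case False
    have "c \<in> eigenvalues A" using Tw False by (auto simp: eigenvalues_def)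
    moreover have "norm (T w) = norm w"
      using isometric_part_matrix_poly[OF Suc.prems(1), of q]
      by (auto simp: w_def isometric_part_def dest: spec[of _ 1])
    then have "norm c = 1" using False by (simp add: Tw norm_scalar_vector)
    ultimately obtain M where M: "M \<ge> 1" "c ^ M = 1"
      using roots by (auto simp: root_of_one_def)
    obtain N where N: "N \<ge> 1" "(T ^^ N) u = u" using Suc.hyps(1)[OF q(2) u q(1) qu] by blast
    define L where "L = N * M"
    have Lu: "(T ^^ L) u = u" using power_multiple_fixed[OF N(2)] by (simp add: L_def)
    \<comment> \<open>This difference is a combination of iterates of \<open>u\<close>, all fixed by
      \<open>T ^^ L\<close>. At \<open>k = L\<close> the factor \<open>c ^ L\<close> is 1.\<close>
    have "(T ^^ L) ((T ^^ k) y - c ^ k *s y) = (T ^^ k) y - c ^ k *s y" for k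
    proof (induction k)
      case 0
      show ?case by (simp add: linear_0[OF linear_power])
    next
      case (Suc k)
      have "(T ^^ Suc k) y - c ^ Suc k *s y = T ((T ^^ k) y - c ^ k *s y) + c ^ k *s u"
        by (simp add: u_def matrix_vector_mult_diff_distrib matrix_vector_mult_smult
            vector_ssub_ldistrib vector_smult_assoc mult.commute)
      moreover have "(T ^^ L) (T z) = T ((T ^^ L) z)" for z
        by (simp add: funpow_swap1)
      ultimately show ?case
        using Suc by (simp add: linear_add[OF linear_power] power_smult Lu)
    qed
    from this[of L] have "(T ^^ L) ((T ^^ L) y - y) = (T ^^ L) y - y"
      using M by (simp add: L_def power_mult mult.commute[of N])
    from fixed_of_bounded_orbit[OF this] show ?thesis
      using N M by (intro exI[of _ L]) (simp add: L_def)
  qed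
qed

text \<open>The product of the periods of the vectors of a finite basis is a common period.\<close>

lemma isometric_part_periodic:
  assumes "\<And>c. c \<in> eigenvalues A \<Longrightarrow> norm c = 1 \<Longrightarrow> root_of_one c"
  obtains N where "N \<ge> 1" "\<And>y. y \<in> isometric_part \<Longrightarrow> (T ^^ N) y = y"
proof -
  obtain B where B: "B \<subseteq> isometric_part" "independent B" "isometric_part \<subseteq> span B"
    by (rule maximal_independent_subset)
  have "\<forall>b\<in>B. \<exists>N\<ge>1. (T ^^ N) b = b"
    using B exists_annihilating_poly isometric_part_periodic_vector[OF assms] by (metis subsetD)
  then obtain n where n: "\<And>b. b \<in> B \<Longrightarrow> n b \<ge> 1 \<and> (T ^^ n b) b = b" by metis
  have fin: "finite B" using B(2) independent_bound by blast
  define N where "N = prod n B"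
  have "(T ^^ N) b = b" if "b \<in> B" for b
  proof -
    have "N = n b * prod n (B - {b})" using fin that by (simp add: N_def prod.remove)
    then show ?thesis using n[OF that] power_multiple_fixed by metis
  qed
  then have "(T ^^ N) y = y" if "y \<in> span B" for y
    using linear_eq_on_span[OF linear_power linear_id, of B N y] that by simp
  moreover have "N \<ge> 1"
    unfolding N_def using n by (intro prod_ge_1) auto
  ultimately show ?thesis using that B by blast
qed

section \<open>The orthogonal complement and its geometric decay\<close>

definition decaying_part :: "(complex^'n) set" where
  "decaying_part = {y. \<forall>x\<in>isometric_part. inner x y = 0}"

text \<open>The complement is taken for the real inner product; it is stable under complex scalars
  because \<open>isometric_part\<close> is.\<close>

lemma decaying_part_smult: "y \<in> decaying_part \<Longrightarrow> c *s y \<in> decaying_part"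
  unfolding decaying_part_def
  using isometric_part_smult by (auto simp flip: inner_smult_left_complex[of "cnj c", simplified])

lemma isometric_decaying_decomp:
  obtains a b where "z = a + b" "a \<in> isometric_part" "b \<in> decaying_part"
proof -
  have sp: "span isometric_part = isometric_part"
    using subspace_isometric_part by (rule span_eq_iff[THEN iffD2])
  obtain a b where "a \<in> span isometric_part" "\<And>w. w \<in> span isometric_part \<Longrightarrow> orthogonal b w" "z = a + b"
    using orthogonal_subspace_decomp_exists[of isometric_part z] by blast
  then show ?thesis
    using that[of a b] sp
    by (auto simp: decaying_part_def orthogonal_def inner_commute)
qed

lemma norm_isometric_plus_decaying:
  assumes "x \<in> isometric_part" "y \<in> decaying_part"
  shows "(norm (x + y))\<^sup>2 = (norm x)\<^sup>2 + (norm y)\<^sup>2"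
  using assms by (simp add: power2_norm_eq_inner inner_add_left inner_add_right inner_commute decaying_part_def)

text \<open>By periodicity each isometric \<open>x\<close> is the image under \<open>T ^^ k\<close>
  of an isometric \<open>x'\<close>, and \<open>inner_power_eq\<close> then removes
  \<open>T ^^ k\<close> from both arguments.\<close>

lemma decaying_part_power:
  assumes per: "N \<ge> 1" "\<And>x. x \<in> isometric_part \<Longrightarrow> (T ^^ N) x = x" and y: "y \<in> decaying_part"
  shows "(T ^^ k) y \<in> decaying_part"
proof -
  have "inner x ((T ^^ k) y) = 0" if x: "x \<in> isometric_part" for x
  proof -
    define x' where "x' = (T ^^ (N * k - k)) x"
    have x': "x' \<in> isometric_part" using x by (simp add: x'_def isometric_part_power)
    have "k \<le> N * k" using per(1) by simp
    then have "(T ^^ k) x' = (T ^^ (N * k)) x"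
      unfolding x'_def by (simp flip: funpow_add[THEN fun_cong, unfolded o_def])
    also have "\<dots> = x" using per(2)[OF x] by (rule power_multiple_fixed)
    finally have "inner x ((T ^^ k) y) = inner ((T ^^ k) x') ((T ^^ k) y)" by simp
    also have "\<dots> = inner x' y"
      using x' by (intro inner_power_eq) (simp add: isometric_part_def)
    also have "\<dots> = 0" using x' y by (simp add: decaying_part_def)
    finally show ?thesis .
  qed
  then show ?thesis by (simp add: decaying_part_def)
qed

text \<open>Each unit vector here is strictly shortened by some power. Compactness leaves finitely
  many powers, norms decrease along orbits, so a single \<open>K\<close> serves all, and the maximum
  over the sphere is attained.\<close>

lemma decaying_part_contracted:
  obtains K \<rho> where "K \<ge> 1" "0 < \<rho>" "\<rho> < 1"
    "\<And>y. y \<in> decaying_part \<Longrightarrow> norm ((T ^^ K) y) \<le> \<rho> * norm y"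
proof -
  define S where "S = decaying_part \<inter> sphere 0 1"
  have "closed decaying_part"
  proof -
    have "decaying_part = (\<Inter>x\<in>isometric_part. {y. inner x y = 0})"
      by (auto simp: decaying_part_def)
    then show ?thesis
      by (auto intro!: closed_INT closed_Collect_eq continuous_intros)
  qed
  then have S: "compact S"
    unfolding S_def by (intro closed_Int_compact) auto
  have cont: "continuous_on X (\<lambda>x. norm ((T ^^ k) x))" for k X
    by (intro continuous_intros linear_continuous_on bounded_linear_power)
  have "S \<subseteq> (\<Union>k\<in>UNIV. {x. norm ((T ^^ k) x) < 1})"
  proof
    fix x assume x: "x \<in> S"
    \<comment> \<open>Otherwise \<open>x\<close> would be orthogonal to itself.\<close>
    have "x \<notin> isometric_part"
      using x by (auto simp: S_def decaying_part_def)
    then obtain k where "norm ((T ^^ k) x) \<noteq> 1" using x by (auto simp: isometric_part_def S_def)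
    then show "x \<in> (\<Union>k\<in>UNIV. {x. norm ((T ^^ k) x) < 1})"
      using contraction_power[of k x] x by (auto simp: S_def intro!: exI[of _ k])
  qed
  then obtain C' where C': "finite C'" "S \<subseteq> (\<Union>k\<in>C'. {x. norm ((T ^^ k) x) < 1})"
    by (rule compactE_image[OF S, rotated])
       (auto intro!: open_Collect_less cont)
  \<comment> \<open>\<open>insert 0\<close> covers an empty \<open>C'\<close>, and
    \<open>Suc\<close> ensures \<open>K \<ge> 1\<close>.\<close>
  define K where "K = Suc (Max (insert 0 C'))"
  have lt: "norm ((T ^^ K) x) < 1" if x: "x \<in> S" for x
  proof -
    obtain k where k: "k \<in> C'" "norm ((T ^^ k) x) < 1" using C' x by blast
    have "k \<le> K" unfolding K_def using C' k by (intro le_SucI Max_ge) auto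
    then show ?thesis using contraction_power_antimono[of k K x] k by simp
  qed
  obtain \<rho> where \<rho>: "0 < \<rho>" "\<rho> < 1" "\<And>x. x \<in> S \<Longrightarrow> norm ((T ^^ K) x) \<le> \<rho>"
  proof (cases "S = {}")
    case True
    then show thesis using that[of "1/2"] by simp
  next
    case False
    then obtain x where x: "x \<in> S" "\<And>y. y \<in> S \<Longrightarrow> norm ((T ^^ K) y) \<le> norm ((T ^^ K) x)"
      using continuous_attains_sup[OF S _ cont] by blast
    \<comment> \<open>The \<open>1/2\<close> keeps \<open>\<rho>\<close> positive even if
      \<open>T ^^ K\<close> vanishes on \<open>S\<close>.\<close>
    show thesis
      using lt[OF x(1)] x(2) by (intro that[of "max (1/2) (norm ((T ^^ K) x))"]) (auto simp: le_max_iff_disj)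
  qed
  have "norm ((T ^^ K) y) \<le> \<rho> * norm y" if y: "y \<in> decaying_part" for y
  proof (cases "y = 0")
    case True
    then show ?thesis by (simp add: linear_0[OF linear_power])
  next
    case False
    have "(1 / norm y) *\<^sub>R y \<in> S"
      using y False by (simp add: S_def decaying_part_def)
    from \<rho>(3)[OF this] show ?thesis
      using False by (simp add: linear_scale[OF linear_power] field_simps)
  qed
  with \<rho> show ?thesis by (intro that[of K \<rho>]) (auto simp: K_def)
qed

text \<open>The contraction is iterated \<open>m div K\<close> times; the remaining steps do not
  increase the norm.\<close>

lemma decaying_part_geometric:
  assumes per: "N \<ge> 1" "\<And>x. x \<in> isometric_part \<Longrightarrow> (T ^^ N) x = x"
    and \<rho>: "0 < \<rho>" "\<And>y. y \<in> decaying_part \<Longrightarrow> norm ((T ^^ K) y) \<le> \<rho> * norm y"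
    and y: "y \<in> decaying_part"
  shows "norm ((T ^^ m) y) \<le> \<rho> ^ (m div K) * norm y"
proof -
  have *: "norm ((T ^^ (K * j)) y) \<le> \<rho> ^ j * norm y" for j
  proof (induction j)
    case (Suc j)
    have "norm ((T ^^ (K * Suc j)) y) = norm ((T ^^ K) ((T ^^ (K * j)) y))" by (simp add: funpow_add)
    also have "\<dots> \<le> \<rho> * norm ((T ^^ (K * j)) y)"
      by (intro \<rho> decaying_part_power[OF per y])
    also have "\<dots> \<le> \<rho> * (\<rho> ^ j * norm y)" using Suc \<rho> by (intro mult_left_mono) auto
    finally show ?case by (simp add: mult_ac)
  qed simp
  have "norm ((T ^^ m) y) \<le> norm ((T ^^ (K * (m div K))) y)"
    by (intro contraction_power_antimono) simp
  then show ?thesis using *[of "m div K"] by linarith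
qed

end

section \<open>Sufficiency of the eigenvalue condition\<close>

text \<open>For the converse, \<open>z\<close> is rescaled into the ball by any
  \<open>s > norm z\<close>, and then \<open>s\<close> tends to \<open>norm z\<close>.\<close>

lemma matrix_contraction_iff_SUP:
  fixes A :: "complex^'n^'n"
  shows "matrix_contraction A \<longleftrightarrow> (SUP z\<in>ball 0 1. norm (A *v z)) \<le> 1"
proof
  assume "matrix_contraction A"
  then interpret matrix_contraction A .
  show "(SUP z\<in>ball 0 1. norm (A *v z)) \<le> 1"
  proof (rule cSUP_least)
    show "norm (A *v z) \<le> 1" if "z \<in> ball 0 1" for z
      using contraction[of z] that by simp
  qed simp
next
  assume sup: "(SUP z\<in>ball 0 1. norm (A *v z)) \<le> 1"
  show "matrix_contraction A"
  proof
    fix z :: "complex^'n"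
    show "norm (A *v z) \<le> norm z"
    proof (rule dense_ge)
      fix s assume s: "norm z < s"
      then have s0: "s > 0" using norm_ge_zero[of z] by linarith
      have "A *v ((1 / s) *\<^sub>R z) \<in> ball 0 1"
        using s s0 by (intro matrix_self_map_ball[OF sup]) simp
      moreover have "A *v ((1 / s) *\<^sub>R z) = (1 / s) *\<^sub>R (A *v z)"
        by (rule linear_scale[OF bounded_linear.linear]) (rule matrix_vector_mul_bounded_linear)
      ultimately show "norm (A *v z) \<le> s" using s0 by (simp add: field_simps)
    qed
  qed
qed

lemma apply_Hinf_sum: "apply_Hinf (sum f I) z = (\<Sum>i\<in>I. apply_Hinf (f i) z)"
  by (induction I rule: infinite_finite_induct) simp_all

context matrix_contraction
begin

section \<open>Powers and means of the composition operator\<close>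

abbreviation C :: "'n Hinf \<Rightarrow>\<^sub>L 'n Hinf" where "C \<equiv> composition_operator T"

abbreviation C_power :: "nat \<Rightarrow> 'n Hinf \<Rightarrow>\<^sub>L 'n Hinf" where
  "C_power i \<equiv> ((\<lambda>S. C o\<^sub>L S) ^^ i) id_blinfun"

lemma power_in_ball: "z \<in> ball 0 1 \<Longrightarrow> (T ^^ i) z \<in> ball 0 1"
  using contraction_power[of i z] by (simp add: order_le_less_trans)

lemma apply_C_power: "z \<in> ball 0 1 \<Longrightarrow> apply_Hinf (C_power i f) z = apply_Hinf f ((T ^^ i) z)"
proof (induction i arbitrary: z)
  case (Suc i)
  have SUP: "(SUP z\<in>ball 0 1. norm (A *v z)) \<le> 1"
    using matrix_contraction_axioms matrix_contraction_iff_SUP by blast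
  have "apply_Hinf (C_power (Suc i) f) z = apply_Hinf (C_power i f) (T z)"
    by (simp add: apply_composition_operator[OF SUP Suc.prems])
  also have "\<dots> = apply_Hinf f ((T ^^ i) (T z))"
    using power_in_ball[OF Suc.prems, of 1] by (intro Suc.IH) simp
  finally show ?case by (simp add: funpow_swap1)
qed simp

lemma apply_cesaro_mean:
  assumes "z \<in> ball 0 1"
  shows "apply_Hinf (cesaro_mean C j f) z = (1 / real j) *\<^sub>R (\<Sum>i=1..j. apply_Hinf f ((T ^^ i) z))"
  by (simp add: cesaro_mean_def blinfun.scaleR_left blinfun.sum_left apply_Hinf_sum
      apply_C_power[OF assms])

lemma norm_C_power: "norm (C_power i) \<le> 1"
  by (intro norm_blinfun_bound norm_Hinf_le) (simp_all only: apply_C_power mult_1 norm_apply_Hinf_le zero_le_one)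

text \<open>Orthogonality of the two parts leaves room for the disc \<open>|s| < 1 / t\<close> in the direction \<open>y\<close>.\<close>

lemma apply_Hinf_decaying_perturbation:
  assumes "x \<in> isometric_part" "y \<in> decaying_part" "0 < t" "t \<le> 1"
    and "norm x \<le> norm a" "norm y \<le> t * norm b" "(norm a)\<^sup>2 + (norm b)\<^sup>2 < 1"
  shows "norm (apply_Hinf f (x + y) - apply_Hinf f x) \<le> 3 * t * norm f"
proof (rule Hinf_Schwarz)
  fix s :: complex assume s: "norm s < 1 / t"
  have "norm s * norm y \<le> (1 / t) * (t * norm b)"
    using assms s by (intro mult_mono) auto
  then have "norm (s *s y) \<le> norm b" using assms by (simp add: norm_scalar_vector)
  then have "(norm (s *s y))\<^sup>2 \<le> (norm b)\<^sup>2" "(norm x)\<^sup>2 \<le> (norm a)\<^sup>2"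
    using assms by (auto intro: power_mono)
  then have "(norm (x + s *s y))\<^sup>2 < 1"
    using norm_isometric_plus_decaying[OF assms(1) decaying_part_smult[OF assms(2), of s]] assms by linarith
  then have "norm (x + s *s y) < 1" by (simp add: abs_square_less_1)
  then show "x + s *s y \<in> ball 0 1" by simp
qed (use assms in auto)

text \<open>\<open>N\<close> further steps leave the isometric component of an orbit unchanged, so
  \<open>f\<close> at times \<open>i\<close> and \<open>i + N\<close> is close to its value at that
  component. The bound is geometric in operator norm, and the bounded operators form a Banach
  space.\<close>

lemma uniformly_mean_ergodic_if_roots:
  assumes "\<And>c. c \<in> eigenvalues A \<Longrightarrow> norm c = 1 \<Longrightarrow> root_of_one c"
  shows "uniformly_mean_ergodic C"
proof -
  obtain N where N: "N \<ge> 1" "\<And>y. y \<in> isometric_part \<Longrightarrow> (T ^^ N) y = y"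
    using isometric_part_periodic assms by blast
  obtain K \<rho> where K: "K \<ge> 1" "0 < \<rho>" "\<rho> < 1"
    "\<And>y. y \<in> decaying_part \<Longrightarrow> norm ((T ^^ K) y) \<le> \<rho> * norm y"
    using decaying_part_contracted by blast
  have est: "norm (C_power (i + N) - C_power i) \<le> 6 * \<rho> ^ (i div K)" for i
  proof (rule norm_blinfun_bound)
    define t where "t = \<rho> ^ (i div K)"
    have t: "0 < t" "t \<le> 1" using K by (auto simp: t_def power_le_one)
    then show "0 \<le> 6 * \<rho> ^ (i div K)" by (simp add: t_def)
    fix f
    show "norm ((C_power (i + N) - C_power i) f) \<le> 6 * \<rho> ^ (i div K) * norm f"
    proof (rule norm_Hinf_le)
      fix z :: "complex^'n" assume z: "z \<in> ball 0 1"
      obtain a b where ab: "z = a + b" "a \<in> isometric_part" "b \<in> decaying_part"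
        by (rule isometric_decaying_decomp)
      have "(norm z)\<^sup>2 < 1" using z by (simp add: abs_square_less_1)
      then have lt: "(norm a)\<^sup>2 + (norm b)\<^sup>2 < 1"
        using norm_isometric_plus_decaying[OF ab(2,3)] ab(1) by simp
      define x where "x = (T ^^ i) a"
      have x: "x \<in> isometric_part" using ab by (simp add: x_def isometric_part_power)
      have Tx: "(T ^^ (i + N)) a = x"
        using N(2)[OF ab(2)] by (simp add: x_def funpow_add)
      \<comment> \<open>Stated for all \<open>m \<ge> i\<close> so as to serve \<open>i\<close> and
        \<open>i + N\<close> alike; the two uses add up to the constant 6.\<close>
      have close: "norm (apply_Hinf f (x + (T ^^ m) b) - apply_Hinf f x) \<le> 3 * t * norm f" if "m \<ge> i" for m
      proof (rule apply_Hinf_decaying_perturbation[OF x _ t _ _ lt])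
        show "(T ^^ m) b \<in> decaying_part" by (rule decaying_part_power[OF N ab(3)])
        show "norm x \<le> norm a" unfolding x_def by (rule contraction_power)
        show "norm ((T ^^ m) b) \<le> t * norm b"
          using decaying_part_geometric[OF N K(2,4) ab(3), of i] contraction_power_antimono[OF that, of b]
          unfolding t_def by linarith
      qed
      have "apply_Hinf ((C_power (i + N) - C_power i) f) z
          = apply_Hinf f (x + (T ^^ (i + N)) b) - apply_Hinf f (x + (T ^^ i) b)"
        by (simp add: blinfun.diff_left apply_C_power[OF z] del: funpow.simps)
           (simp add: ab(1) linear_add[OF linear_power] Tx x_def)
      also have "norm \<dots> \<le> norm (apply_Hinf f (x + (T ^^ (i + N)) b) - apply_Hinf f x)
          + norm (apply_Hinf f (x + (T ^^ i) b) - apply_Hinf f x)"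
        by (rule order_trans[OF _ norm_triangle_ineq4]) simp
      also have "\<dots> \<le> 3 * t * norm f + 3 * t * norm f"
        by (intro add_mono close) simp_all
      finally show "norm (apply_Hinf ((C_power (i + N) - C_power i) f) z) \<le> 6 * \<rho> ^ (i div K) * norm f"
        by (simp add: t_def mult_ac)
    qed
  qed
  have "summable (\<lambda>i. norm (C_power (i + N) - C_power i))"
    by (rule summable_comparison_test'[OF summable_mult[OF summable_power_div[OF K(2,3,1)], of 6], of 0])
       (use est in simp)
  from asymptotically_periodic_mean_convergent[OF norm_C_power N(1) this]
  show ?thesis
    unfolding uniformly_mean_ergodic_def cesaro_mean_def convergent_def .
qed

end

section \<open>Rotations of the disc\<close>

text \<open>A convergent subsequence of the powers has two distinct exponents with close values;
  their difference is the required exponent, since dividing by a unimodular power keeps the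
  distance.\<close>

lemma unimodular_powers_near_one:
  fixes c :: complex
  assumes "norm c = 1" "e > 0"
  obtains n where "n \<ge> 1" "norm (c ^ n - 1) < e"
proof -
  have "bounded (range (\<lambda>n. c ^ n))"
    unfolding bounded_iff using assms(1) by (auto simp: norm_power intro!: exI[of _ 1])
  then obtain l r where r: "strict_mono (r :: nat \<Rightarrow> nat)" "((\<lambda>n. c ^ n) \<circ> r) \<longlonglongrightarrow> l"
    using bounded_imp_convergent_subsequence by metis
  then obtain M where M: "\<And>m n. m \<ge> M \<Longrightarrow> n \<ge> M \<Longrightarrow> norm (c ^ r m - c ^ r n) < e"
    using CauchyD[OF LIMSEQ_imp_Cauchy[OF r(2)] assms(2)] by auto
  define p where "p = r M"
  define q where "q = r (Suc M) - r M"
  have lt: "r M < r (Suc M)" using r(1) by (simp add: strict_mono_Suc_iff)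
  have "norm (c ^ (p + q) - c ^ p) < e" using M[of "Suc M" M] lt by (simp add: p_def q_def)
  also have "c ^ (p + q) - c ^ p = c ^ p * (c ^ q - 1)" by (simp add: power_add algebra_simps)
  finally have "norm (c ^ q - 1) < e" using assms(1) by (simp add: norm_mult norm_power)
  then show ?thesis using that[of q] lt by (simp add: q_def)
qed

text \<open>The Poisson kernel, nonnegative on the disc.\<close>

lemma Re_cayley: "Re ((1 + w) / (1 - w)) = (1 - (norm w)\<^sup>2) / (norm (1 - w))\<^sup>2"
proof -
  have "Re ((1 + w) * cnj (1 - w)) = 1 - (norm w)\<^sup>2"
    unfolding cmod_power2 by (simp add: power2_eq_square algebra_simps)
  moreover have "(1 + w) / (1 - w) = ((1 + w) * cnj (1 - w)) / of_real ((norm (1 - w))\<^sup>2)"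
    by (subst complex_div_cnj) simp
  ultimately show ?thesis by (simp only: Re_divide_of_real)
qed

text \<open>A bound independent of \<open>n\<close>, as the Weierstrass test for the series of the
  \<open>g k\<close> requires.\<close>

lemma norm_cayley_power_le:
  fixes z :: complex
  assumes "norm z < 1" "n \<ge> 1"
  shows "norm ((1 + z ^ n) / (1 - z ^ n)) \<le> 2 / (1 - norm z)"
proof -
  have le: "norm (z ^ n) \<le> norm z"
    using assms power_decreasing[of 1 n "norm z"] unfolding norm_power by simp
  have "norm (1 + z ^ n) \<le> 2" using norm_triangle_ineq[of 1 "z ^ n"] le assms by simp
  moreover have "norm (1 - z ^ n) \<ge> 1 - norm z" using norm_triangle_ineq2[of 1 "z ^ n"] le by simp
  ultimately show ?thesis
    unfolding norm_divide using assms by (intro frac_le) auto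
qed

text \<open>An atomic singular inner function: its atoms are the \<open>n\<^sub>k\<close>-th roots of unity, where \<open>c\<^bsup>n\<^sub>k\<^esup>\<close> is so
  close to \<open>1\<close> that the \<open>k\<close>-th factor is small at \<open>c w, \<dots>, c\<^bsup>k\<^esup> w\<close> for a point \<open>w\<close> with
  \<open>w\<^bsup>n\<^sub>k\<^esup>\<close> near \<open>1\<close>.\<close>

lemma exists_function_small_on_orbit_segments:
  assumes c: "norm (c::complex) = 1"
  obtains h :: "complex \<Rightarrow> complex" where "h holomorphic_on ball 0 1"
    "\<And>z. norm z < 1 \<Longrightarrow> norm (h z) \<le> 1" "h 0 = exp (-2)"
    "\<And>k. \<exists>w. norm w < 1 \<and> (\<forall>i\<in>{1..k}. norm (h (c ^ i * w)) \<le> exp (-3))"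
proof -
  define cay :: "complex \<Rightarrow> complex" where "cay = (\<lambda>w. (1 + w) / (1 - w))"
  define \<epsilon> :: "nat \<Rightarrow> real" where "\<epsilon> = (\<lambda>k. (1/2) ^ k)"
  have \<epsilon>: "0 < \<epsilon> k" "\<epsilon> k \<le> 1" for k by (auto simp: \<epsilon>_def power_le_one)
  \<comment> \<open>Here \<open>\<epsilon> k * cay (s k) = 8 - \<epsilon> k\<close>, well above
    3.\<close>
  define s where "s = (\<lambda>k. 1 - \<epsilon> k / 4)"
  have s: "0 < s k" "s k < 1" for k using \<epsilon>[of k] by (auto simp: s_def)
  have "\<exists>n\<ge>1. \<forall>i\<in>{1..k}. \<epsilon> k * Re (cay ((c ^ n) ^ i * s k)) > 3" for k
  proof -
    have ne: "complex_of_real (s k) \<noteq> 1" using s[of k] by (metis of_real_eq_1_iff less_irrefl)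
    have "cay (s k) = of_real ((2 - \<epsilon> k / 4) / (\<epsilon> k / 4))"
      by (simp add: cay_def s_def)
    then have "Re (cay (s k)) = (2 - \<epsilon> k / 4) / (\<epsilon> k / 4)" by (metis Re_complex_of_real)
    then have "\<epsilon> k * Re (cay (s k)) > 3" using \<epsilon>[of k] by (simp add: field_simps)
    moreover have "isCont (\<lambda>w. \<epsilon> k * Re (cay w)) (s k)"
      unfolding cay_def using ne by (intro continuous_intros) auto
    then have "((\<lambda>w. \<epsilon> k * Re (cay w)) \<longlongrightarrow> \<epsilon> k * Re (cay (s k))) (nhds (complex_of_real (s k)))"
      unfolding isCont_def using tendsto_at_iff_tendsto_nhds[of "\<lambda>w. \<epsilon> k * Re (cay w)"] by simp
    ultimately have "\<forall>\<^sub>F w in nhds (complex_of_real (s k)). \<epsilon> k * Re (cay w) > 3"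
      by (rule order_tendstoD(1)[rotated])
    then obtain \<delta> where \<delta>: "\<delta> > 0" "\<And>w. dist w (complex_of_real (s k)) < \<delta> \<Longrightarrow> \<epsilon> k * Re (cay w) > 3"
      unfolding eventually_nhds_metric by blast
    \<comment> \<open>The error of \<open>c ^ n\<close> grows at most linearly in the exponent, so
      division by \<open>k + 1\<close> controls the first \<open>k\<close> powers.\<close>
    obtain n where n: "n \<ge> 1" "norm (c ^ n - 1) < \<delta> / (real k + 1)"
      using unimodular_powers_near_one[OF c, of "\<delta> / (real k + 1)"] \<delta> by auto
    have "dist ((c ^ n) ^ i * s k) (s k) < \<delta>" if "i \<in> {1..k}" for i
    proof -
      have "norm ((c ^ n) ^ i - 1 ^ i) \<le> real i * norm (c ^ n - 1)"
        using c by (intro norm_power_diff) (auto simp: norm_power)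
      also have "\<dots> \<le> (real k + 1) * norm (c ^ n - 1)" using that by (intro mult_right_mono) auto
      also have "\<dots> < \<delta>" using n by (simp add: field_simps)
      finally have "norm ((c ^ n) ^ i - 1) < \<delta>" by simp
      moreover have "(c ^ n) ^ i * s k - s k = ((c ^ n) ^ i - 1) * s k" by (simp add: algebra_simps)
      then have "norm ((c ^ n) ^ i * s k - s k) \<le> norm ((c ^ n) ^ i - 1) * 1"
        using s[of k] by (simp only: norm_mult) (intro mult_left_mono, auto)
      ultimately show ?thesis by (simp add: dist_norm)
    qed
    then show ?thesis using n \<delta> by blast
  qed
  then obtain n where n: "\<And>k. n k \<ge> 1"
    "\<And>k i. i \<in> {1..k} \<Longrightarrow> \<epsilon> k * Re (cay ((c ^ n k) ^ i * s k)) > 3"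
    by metis
  \<comment> \<open>The weights sum to 2, which gives \<open>exp (-2)\<close> at the origin, while
    one summand alone can push \<open>exp (- G)\<close> down to \<open>exp (-3)\<close>.\<close>
  define g where "g = (\<lambda>k z. \<epsilon> k *\<^sub>R cay (z ^ n k))"
  define G where "G = (\<lambda>z. \<Sum>k. g k z)"
  have pow: "norm (z ^ n k) < 1" if "norm z < 1" for z :: complex and k
    using that n[of k] by (simp add: norm_power power_Suc_less_one power_less_one_iff)
  have gbound: "norm (g k z) \<le> \<epsilon> k * (2 / (1 - r))" if "norm z \<le> r" "r < 1" for k z r
  proof -
    have "norm (cay (z ^ n k)) \<le> 2 / (1 - norm z)"
      unfolding cay_def using that n by (intro norm_cayley_power_le) auto
    also have "\<dots> \<le> 2 / (1 - r)" using that by (intro divide_left_mono mult_pos_pos) auto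
    finally have "\<epsilon> k * norm (cay (z ^ n k)) \<le> \<epsilon> k * (2 / (1 - r))"
      using \<epsilon>[of k] by (intro mult_left_mono) auto
    then show ?thesis using \<epsilon>[of k] by (simp add: g_def)
  qed
  have sm\<epsilon>: "summable (\<lambda>k. \<epsilon> k * b)" for b
    unfolding \<epsilon>_def by (intro summable_mult2 summable_geometric) simp
  have smg: "summable (\<lambda>k. g k z)" if "norm z < 1" for z
    by (rule summable_comparison_test'[OF sm\<epsilon>]) (rule gbound[OF order_refl that])
  have holg: "g k holomorphic_on ball 0 1" for k
  proof -
    have "z ^ n k \<noteq> 1" if "norm z < 1" for z :: complex using pow[OF that, of k] by auto
    then show ?thesis
      unfolding g_def cay_def scaleR_conv_of_real by (intro holomorphic_intros) auto
  qed
  have holG: "G holomorphic_on ball 0 1"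
  proof (rule holomorphic_uniform_sequence[OF open_ball])
    show "(\<lambda>z. \<Sum>k<m. g k z) holomorphic_on ball 0 1" for m
      by (intro holomorphic_on_sum holg)
    fix x :: complex assume x: "x \<in> ball 0 1"
    define d where "d = (1 - norm x) / 2"
    have d: "d > 0" using x by (simp add: d_def)
    have le: "norm z \<le> (1 + norm x) / 2" if "z \<in> cball x d" for z
      using that norm_triangle_ineq2[of z x] by (simp add: d_def dist_norm norm_minus_commute field_simps)
    have r1: "(1 + norm x) / 2 < 1" using x by simp
    have "cball x d \<subseteq> ball 0 1" using le r1 by (force simp: order_le_less_trans)
    moreover have "uniform_limit (cball x d) (\<lambda>m z. \<Sum>k<m. g k z) G sequentially"
      unfolding G_def by (rule Weierstrass_m_test[OF gbound[OF le r1] sm\<epsilon>])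
    ultimately show "\<exists>d>0. cball x d \<subseteq> ball 0 1 \<and> uniform_limit (cball x d) (\<lambda>m z. \<Sum>k<m. g k z) G sequentially"
      using d by blast
  qed
  have Re_g: "Re (g k z) \<ge> 0" if "norm z < 1" for k z
    unfolding g_def cay_def
    using \<epsilon>[of k] pow[OF that, of k] by (simp add: Re_cayley abs_square_le_1 del: norm_power)
  \<comment> \<open>All summands have nonnegative real part, so each of them is a lower
    bound.\<close>
  have Re_G: "Re (g k z) \<le> Re (G z)" if "norm z < 1" for k z
  proof -
    have "(\<lambda>k. Re (g k z)) sums Re (G z)"
      unfolding G_def using smg[OF that] by (intro sums_Re summable_sums)
    then show ?thesis
      using sum_le_suminf[of "\<lambda>k. Re (g k z)" "{k}"] Re_g[OF that] by (simp add: sums_iff)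
  qed
  show ?thesis
  proof (rule that[of "\<lambda>z. exp (- G z)"])
    show "(\<lambda>z. exp (- G z)) holomorphic_on ball 0 1" by (intro holomorphic_intros holG)
    show "norm (exp (- G z)) \<le> 1" if "norm z < 1" for z
      using Re_g[OF that, of 0] Re_G[OF that, of 0] by simp
    have "g k 0 = of_real ((1/2) ^ k)" for k
      using n(1)[of k] by (simp add: g_def cay_def \<epsilon>_def power_0_left scaleR_conv_of_real)
    moreover have "(\<lambda>k. complex_of_real ((1/2) ^ k)) sums of_real (1 / (1 - 1/2))"
      by (intro sums_of_real geometric_sums) simp
    ultimately have "G 0 = 2" by (simp add: G_def sums_iff)
    then show "exp (- G 0) = exp (-2)" by simp
    fix k
    \<comment> \<open>This root makes the \<open>n k\<close>-th power of \<open>c ^ i * w\<close>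
      equal to \<open>(c ^ n k) ^ i * s k\<close>, where the \<open>k\<close>-th summand was shown
      to be large.\<close>
    define w where "w = complex_of_real (root (n k) (s k))"
    have nk: "n k > 0" using n(1)[of k] by simp
    have w: "w ^ n k = of_real (s k)" "norm w < 1"
      using s[of k] nk by (simp_all add: w_def real_root_pow_pos2 flip: of_real_power)
    have "norm (exp (- G (c ^ i * w))) \<le> exp (-3)" if i: "i \<in> {1..k}" for i
    proof -
      have "(c ^ i * w) ^ n k = (c ^ n k) ^ i * s k"
        by (simp add: power_mult_distrib w mult.commute flip: power_mult)
      then have "Re (g k (c ^ i * w)) > 3" using n(2)[OF i] by (simp add: g_def)
      moreover have "norm (c ^ i * w) < 1" using w c by (simp add: norm_mult norm_power)
      ultimately have "Re (G (c ^ i * w)) \<ge> 3" using Re_G[of "c ^ i * w" k] by linarith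
      then show ?thesis by simp
    qed
    then show "\<exists>w. norm w < 1 \<and> (\<forall>i\<in>{1..k}. norm (exp (- G (c ^ i * w))) \<le> exp (-3))"
      using w(2) by blast
  qed
qed

text \<open>The points \<open>c ^ k * z\<close> differ from \<open>z\<close> but accumulate there,
  and \<open>f\<close> is constant on them; the identity theorem applies.\<close>

lemma holomorphic_rotation_invariant_constant:
  assumes c: "norm (c::complex) = 1" "\<not> root_of_one c"
    and hol: "f holomorphic_on ball 0 1" and inv: "\<And>z. norm z < 1 \<Longrightarrow> f (c * z) = f z"
    and z: "norm z < 1"
  shows "f z = f 0"
proof (cases "z = 0")
  case False
  have orbit: "f (c ^ k * z) = f z" for k
  proof (induction k)
    case (Suc k)
    have "norm (c ^ k * z) < 1" using c z by (simp add: norm_mult norm_power)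
    from inv[OF this] Suc show ?case by (simp add: mult.assoc)
  qed simp
  define U where "U = {c ^ k * z |k. k \<ge> 1}"
  have "z islimpt U"
    unfolding islimpt_approachable
  proof (intro allI impI)
    fix e :: real assume e: "e > 0"
    obtain k where k: "k \<ge> 1" "norm (c ^ k - 1) < e / norm z"
      using unimodular_powers_near_one[OF c(1), of "e / norm z"] e False by auto
    have "dist (c ^ k * z) z = norm ((c ^ k - 1) * z)" by (simp add: dist_norm algebra_simps)
    also have "\<dots> < e"
      unfolding norm_mult using k False by (simp add: pos_less_divide_eq)
    finally have "dist (c ^ k * z) z < e" .
    moreover have "c ^ k * z \<noteq> z" using False c(2) k(1) by (auto simp: root_of_one_def)
    ultimately show "\<exists>x'\<in>U. x' \<noteq> z \<and> dist x' z < e" using k(1) by (auto simp: U_def)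
  qed
  have "f 0 - f z = 0"
  proof (rule analytic_continuation[where f = "\<lambda>w. f w - f z" and S = "ball 0 1" and U = U])
    show "(\<lambda>w. f w - f z) holomorphic_on ball 0 1" by (intro holomorphic_intros hol)
    show "U \<subseteq> ball 0 1" using c z by (auto simp: U_def norm_mult norm_power)
    show "f w - f z = 0" if "w \<in> U" for w using that orbit by (auto simp: U_def)
  qed (use \<open>z islimpt U\<close> z in auto)
  then show ?thesis by simp
qed simp

text \<open>A limit would be rotation invariant, hence constantly \<open>exp (-2)\<close>, although
  for each \<open>j\<close> the \<open>j\<close>-th mean is at most \<open>exp (-3)\<close> in
  modulus somewhere.\<close>

lemma exists_rotation_means_not_uniformly_convergent:
  assumes c: "norm (c::complex) = 1" "\<not> root_of_one c"
  obtains h :: "complex \<Rightarrow> complex" where "h holomorphic_on ball 0 1"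
    "\<And>z. norm z < 1 \<Longrightarrow> norm (h z) \<le> 1"
    "\<And>\<phi>. \<phi> holomorphic_on ball 0 1 \<Longrightarrow>
      \<not> uniform_limit (ball 0 1) (\<lambda>j z. (1 / real j) *\<^sub>R (\<Sum>i=1..j. h (c ^ i * z))) \<phi> sequentially"
proof -
  obtain h :: "complex \<Rightarrow> complex" where h: "h holomorphic_on ball 0 1"
    "\<And>z. norm z < 1 \<Longrightarrow> norm (h z) \<le> 1" "h 0 = exp (-2)"
    "\<And>k. \<exists>w. norm w < 1 \<and> (\<forall>i\<in>{1..k}. norm (h (c ^ i * w)) \<le> exp (-3))"
    using exists_function_small_on_orbit_segments[OF c(1)] by metis
  define m where "m = (\<lambda>j z. (1 / real j) *\<^sub>R (\<Sum>i=1..j. h (c ^ i * z)))"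
  have False if hol: "\<phi> holomorphic_on ball 0 1" and ul: "uniform_limit (ball 0 1) m \<phi> sequentially" for \<phi>
  proof -
    have ptw: "(\<lambda>j. m j z) \<longlonglongrightarrow> \<phi> z" if "norm z < 1" for z
      using tendsto_uniform_limitI[OF ul] that by simp
    \<comment> \<open>Rotating the argument shifts the averaged sequence by one, which does not
      affect the limit.\<close>
    have "\<phi> (c * z) = \<phi> z" if z: "norm z < 1" for z
    proof -
      have "norm (c ^ i * z) < 1" for i using z c by (simp add: norm_mult norm_power)
      then have "(\<lambda>j. (1 / real j) *\<^sub>R (\<Sum>i=1..j. h (c ^ (i + 1) * z) - h (c ^ i * z))) \<longlonglongrightarrow> 0"
        by (intro bounded_shift_mean_tendsto[where x = "\<lambda>i. h (c ^ i * z)" and B = 1] h(2))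
      moreover have "(1 / real j) *\<^sub>R (\<Sum>i=1..j. h (c ^ (i + 1) * z) - h (c ^ i * z)) = m j (c * z) - m j z" for j
        by (simp add: m_def sum_subtractf scaleR_diff_right mult_ac)
      ultimately have "(\<lambda>j. m j (c * z) - m j z) \<longlonglongrightarrow> 0" by simp
      moreover have "(\<lambda>j. m j (c * z) - m j z) \<longlonglongrightarrow> \<phi> (c * z) - \<phi> z"
        using z c by (intro tendsto_diff ptw) (auto simp: norm_mult)
      ultimately show ?thesis using LIMSEQ_unique by fastforce
    qed
    then have const: "\<phi> z = \<phi> 0" if "norm z < 1" for z
      using holomorphic_rotation_invariant_constant[OF c hol] that by blast
    have "\<forall>\<^sub>F j in sequentially. m j 0 = h 0"
      unfolding eventually_sequentially
      by (intro exI[of _ 1]) (auto simp: m_def scaleR_conv_of_real)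
    then have \<phi>0: "\<phi> 0 = h 0"
      using ptw[of 0] tendsto_cong[of "\<lambda>j. m j 0" "\<lambda>_. h 0" sequentially] by (simp add: LIMSEQ_const_iff)
    have "exp (-2) - exp (-3::real) > 0" by simp
    then obtain j0 where j0: "\<And>j z. j \<ge> j0 \<Longrightarrow> z \<in> ball 0 1 \<Longrightarrow> dist (m j z) (\<phi> z) < exp (-2) - exp (-3)"
      using ul unfolding uniform_limit_sequentially_iff by blast
    define j where "j = max 1 j0"
    obtain w where w: "norm w < 1" "\<forall>i\<in>{1..j}. norm (h (c ^ i * w)) \<le> exp (-3)" using h(4) by blast
    have "norm (\<Sum>i=1..j. h (c ^ i * w)) \<le> (\<Sum>i=1..j. exp (-3))"
      using w(2) by (intro order_trans[OF norm_sum sum_mono]) auto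
    then have "norm (m j w) \<le> exp (-3)"
      by (simp add: m_def field_simps j_def)
    moreover have "norm (\<phi> w) = exp (-2)" using const[OF w(1)] \<phi>0 h(3) by simp
    moreover have "norm (\<phi> w) \<le> norm (m j w) + dist (m j w) (\<phi> w)"
      by (metis dist_norm norm_minus_commute norm_triangle_sub)
    ultimately show False using j0[of j w] w(1) by (simp add: j_def)
  qed
  then show ?thesis using that[of h] h(1,2) unfolding m_def by blast
qed

section \<open>Necessity of the eigenvalue condition\<close>

lemma uniformly_mean_ergodic_imp_mean_ergodic:
  assumes "uniformly_mean_ergodic S" shows "mean_ergodic S"
proof -
  obtain P where "cesaro_mean S \<longlonglongrightarrow> P" using assms uniformly_mean_ergodic_def by blast
  then have "(\<lambda>j. blinfun_apply (cesaro_mean S j) x) \<longlonglongrightarrow> blinfun_apply P x" for x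
    by (intro blinfun.tendsto tendsto_const)
  then show ?thesis unfolding mean_ergodic_def by blast
qed

text \<open>The complex inner product \<open>\<langle>z, v\<rangle>\<close>, linear in
  \<open>z\<close>; the real part is \<open>inner\<close>.\<close>

definition hermitian_form :: "complex^'n \<Rightarrow> complex^'n \<Rightarrow> complex" where
  "hermitian_form v z = (\<Sum>i\<in>UNIV. z $ i * cnj (v $ i))"

lemma hermitian_form_smult: "hermitian_form v (c *s z) = c * hermitian_form v z"
  by (simp add: hermitian_form_def sum_distrib_left mult_ac)

lemma Re_hermitian_form: "Re (hermitian_form v z) = inner v z"
  by (simp add: hermitian_form_def inner_vec_def inner_complex_def mult_ac)

lemma hermitian_form_self: "hermitian_form v v = of_real ((norm v)\<^sup>2)"
  by (simp add: hermitian_form_def complex_norm_square norm_vec_def L2_set_def sum_nonneg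
      del: of_real_power)

lemma bounded_linear_hermitian_form: "bounded_linear (hermitian_form v)"
  unfolding hermitian_form_def
  by (intro bounded_linear_sum bounded_linear_compose[OF bounded_linear_mult_left bounded_linear_vec_nth])

text \<open>A unimodular factor \<open>u\<close> turns the form into a nonnegative real number, and
  the real Cauchy-Schwarz inequality finishes.\<close>

lemma norm_hermitian_form_le: "norm (hermitian_form v z) \<le> norm v * norm z"
proof (cases "hermitian_form v z = 0")
  case False
  define u where "u = cnj (hermitian_form v z) / norm (hermitian_form v z)"
  have "hermitian_form v (u *s z) = of_real (norm (hermitian_form v z))"
    using False by (simp add: hermitian_form_smult u_def mult.commute complex_norm_square[symmetric] power2_eq_square)
  then have "norm (hermitian_form v z) = inner v (u *s z)" by (metis Re_complex_of_real Re_hermitian_form)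
  also have "\<dots> \<le> norm v * norm (u *s z)" by (rule norm_cauchy_schwarz)
  also have "norm u = 1" using False by (simp add: u_def norm_divide)
  then have "norm (u *s z) = norm z" by (simp add: norm_scalar_vector)
  finally show ?thesis .
qed simp

lemma holomorphic_Cn_on_compose_functional:
  assumes h: "h holomorphic_on X" "open X" and l: "bounded_linear l" "\<And>c v. l (c *s v) = c * l v"
    and sub: "\<And>z. z \<in> S \<Longrightarrow> l z \<in> X"
  shows "holomorphic_Cn_on (\<lambda>z. h (l z)) S"
  unfolding holomorphic_Cn_on_def
proof
  fix z assume "z \<in> S"
  then obtain d where "(h has_field_derivative d) (at (l z))"
    using h sub by (metis holomorphic_on_open)
  from has_derivative_compose[OF bounded_linear_imp_has_derivative[OF l(1)] this[unfolded has_field_derivative_def]]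
  show "\<exists>D. ((\<lambda>z. h (l z)) has_derivative D) (at z) \<and> (\<forall>c v. D (c *s v) = c * D v)"
    by (intro exI[of _ "\<lambda>v. d * l v"]) (simp add: l(2))
qed

context matrix_contraction
begin

text \<open>\<open>T\<close> preserves the norm of \<open>v\<close>, so
  \<open>inner_power_eq\<close> gives the real part of the claim up to the factor
  \<open>cnj c\<close>; replacing \<open>z\<close> by \<open>\<i> *s z\<close> gives the imaginary
  part.\<close>

lemma hermitian_form_eigenvector:
  assumes v: "T v = c *s v" and c: "norm c = 1"
  shows "hermitian_form v (T z) = c * hermitian_form v z"
proof -
  have Re_eq: "Re (cnj c * hermitian_form v (T y)) = Re (hermitian_form v y)" for y
  proof -
    have "inner (T v) (T y) = inner v y"
      using inner_power_eq[of 1 v y] v c by (simp add: norm_scalar_vector)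
    then show ?thesis
      by (simp add: v inner_smult_left_complex Re_hermitian_form hermitian_form_smult[symmetric])
  qed
  have "Re (\<i> * (cnj c * hermitian_form v (T z))) = Re (\<i> * hermitian_form v z)"
    using Re_eq[of "\<i> *s z"] by (simp add: matrix_vector_mult_smult hermitian_form_smult mult.left_commute)
  then have "cnj c * hermitian_form v (T z) = hermitian_form v z"
    using Re_eq[of z] by (intro complex_eqI) simp_all
  then have "c * (cnj c * hermitian_form v (T z)) = c * hermitian_form v z" by simp
  moreover have "c * cnj c = 1" using c by (simp add: complex_norm_square[symmetric])
  ultimately show ?thesis by (simp add: mult.assoc[symmetric])
qed

text \<open>For \<open>f\<close> equal to \<open>h\<close> of the form with \<open>v\<close>, the
  means of \<open>C\<close> on the disc of multiples of \<open>v\<close> are the rotation means of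
  \<open>h\<close>. Strong convergence at this one \<open>f\<close> would make them converge
  uniformly.\<close>

lemma root_of_one_if_mean_ergodic:
  assumes erg: "mean_ergodic C" and "c \<in> eigenvalues A" and c: "norm c = 1"
  shows "root_of_one c"
proof (rule ccontr)
  assume nr: "\<not> root_of_one c"
  obtain u where u: "u \<noteq> 0" "T u = c *s u" using assms(2) by (auto simp: eigenvalues_def)
  define v where "v = complex_of_real (1 / norm u) *s u"
  have v: "norm v = 1" "T v = c *s v"
    using u by (simp_all add: v_def norm_scalar_vector norm_divide matrix_vector_mult_smult vector_smult_assoc mult.commute)
  let ?l = "hermitian_form v"
  obtain h :: "complex \<Rightarrow> complex" where h: "h holomorphic_on ball 0 1"
    "\<And>z. norm z < 1 \<Longrightarrow> norm (h z) \<le> 1"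
    "\<And>\<phi>. \<phi> holomorphic_on ball 0 1 \<Longrightarrow>
      \<not> uniform_limit (ball 0 1) (\<lambda>j z. (1 / real j) *\<^sub>R (\<Sum>i=1..j. h (c ^ i * z))) \<phi> sequentially"
    by (rule exists_rotation_means_not_uniformly_convergent[OF c nr]) (rule that)
  have l_ball: "norm (?l z) < 1" if "z \<in> ball 0 1" for z
    using norm_hermitian_form_le[of v z] v that by simp
  define f where "f = Abs_Hinf (\<lambda>z. if z \<in> ball 0 1 then h (?l z) else 0)"
  have "(\<lambda>z. if z \<in> ball 0 1 then h (?l z) else 0) \<in> Hinf_set"
  proof (rule Hinf_setI[where B = 1])
    have "holomorphic_Cn_on (\<lambda>z. h (?l z)) (ball 0 1)"
      by (rule holomorphic_Cn_on_compose_functional[OF h(1) open_ball bounded_linear_hermitian_form hermitian_form_smult])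
         (use l_ball in simp)
    then show "holomorphic_Cn_on (\<lambda>z. if z \<in> ball 0 1 then h (?l z) else 0) (ball 0 1)"
      by (rule holomorphic_Cn_on_cong[OF open_ball, rotated]) simp
  qed (use h(2) l_ball in auto)
  then have f: "apply_Hinf f z = h (?l z)" if "z \<in> ball 0 1" for z
    using that by (simp add: f_def Abs_Hinf_inverse)
  obtain P where P: "(\<lambda>j. blinfun_apply (cesaro_mean C j) f) \<longlonglongrightarrow> blinfun_apply P f"
    using erg unfolding mean_ergodic_def by blast
  \<comment> \<open>The leading 0 fits the shape \<open>a + t *s b\<close> of
    \<open>holomorphic_Cn_on_line\<close>.\<close>
  define \<phi> where "\<phi> = (\<lambda>t. apply_Hinf (blinfun_apply P f) (0 + t *s v))"
  have line: "0 + t *s v \<in> ball 0 1" if "t \<in> ball 0 1" for t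
    using that v by (simp add: norm_scalar_vector)
  have "\<phi> holomorphic_on ball 0 1"
    unfolding \<phi>_def by (rule holomorphic_Cn_on_line[OF holomorphic_apply_Hinf open_ball line])
  moreover have "uniform_limit (ball 0 1) (\<lambda>j t. (1 / real j) *\<^sub>R (\<Sum>i=1..j. h (c ^ i * t))) \<phi> sequentially"
    unfolding uniform_limit_sequentially_iff
  proof (intro allI impI)
    fix e :: real assume "e > 0"
    then obtain j0 where j0: "\<And>j. j \<ge> j0 \<Longrightarrow> norm (blinfun_apply (cesaro_mean C j) f - blinfun_apply P f) < e"
      using LIMSEQ_D[OF P] by blast
    have "dist ((1 / real j) *\<^sub>R (\<Sum>i=1..j. h (c ^ i * t))) (\<phi> t) < e" if "j \<ge> j0" "t \<in> ball 0 1" for j t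
    proof -
      have "?l ((T ^^ i) (0 + t *s v)) = c ^ i * t" for i
        by (induction i) (simp_all add: hermitian_form_eigenvector[OF v(2) c] hermitian_form_smult hermitian_form_self v(1))
      then have "apply_Hinf (blinfun_apply (cesaro_mean C j) f) (0 + t *s v) = (1 / real j) *\<^sub>R (\<Sum>i=1..j. h (c ^ i * t))"
        unfolding apply_cesaro_mean[OF line[OF that(2)]] by (simp only: f[OF power_in_ball[OF line[OF that(2)]]])
      then have "dist ((1 / real j) *\<^sub>R (\<Sum>i=1..j. h (c ^ i * t))) (\<phi> t)
          = norm (apply_Hinf (blinfun_apply (cesaro_mean C j) f - blinfun_apply P f) (0 + t *s v))"
        by (simp add: dist_norm \<phi>_def)
      also have "\<dots> \<le> norm (blinfun_apply (cesaro_mean C j) f - blinfun_apply P f)"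
        by (rule norm_apply_Hinf_le)
      also have "\<dots> < e" by (rule j0[OF that(1)])
      finally show ?thesis .
    qed
    then show "\<exists>N. \<forall>j\<ge>N. \<forall>t\<in>ball 0 1. dist ((1 / real j) *\<^sub>R (\<Sum>i=1..j. h (c ^ i * t))) (\<phi> t) < e"
      by blast
  qed
  ultimately show False using h(3) by blast
qed

end

theorem mainTheorem3:
  fixes A :: "complex^'n^'n"
  assumes "(SUP z\<in>ball 0 1. norm (A *v z)) \<le> 1"
  shows "(mean_ergodic (composition_operator (\<lambda>z. A *v z))
            \<longleftrightarrow> uniformly_mean_ergodic (composition_operator (\<lambda>z. A *v z))) \<and>
         (uniformly_mean_ergodic (composition_operator (\<lambda>z. A *v z))
            \<longleftrightarrow> eigenvalues A \<subseteq> ball 0 1 \<union> {c \<in> sphere 0 1. root_of_one c})"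
proof -
  interpret matrix_contraction A
    using assms matrix_contraction_iff_SUP by blast
  \<comment> \<open>All eigenvalues lie in the closed disc, so the inclusion restricts only the
    unimodular ones.\<close>
  have "\<forall>c\<in>eigenvalues A. norm c < 1 \<or> norm c = 1"
    using norm_eigenvalue_le_1 by (force simp: eigenvalues_def)
  then have "eigenvalues A \<subseteq> ball 0 1 \<union> {c \<in> sphere 0 1. root_of_one c}
      \<longleftrightarrow> (\<forall>c\<in>eigenvalues A. norm c = 1 \<longrightarrow> root_of_one c)"
    by auto
  then show ?thesis
    using uniformly_mean_ergodic_if_roots uniformly_mean_ergodic_imp_mean_ergodic
      root_of_one_if_mean_ergodic by blast
qed

end
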